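(* Let $\mathcal K$ contain the 3D Lorentz cone, and let $\mathcal U\subset\mathbb R^{n_u}$, $\mathcal V\subset\mathbb R^{n_v}$ be nonempty compact sets with essentially strictly feasible $\mathcal K$-representations $$\mathcal U=\{u:\exists\alpha: Au+B\alpha\leq_{\mathbf K}a\},\qquad\mathcal V=\{v:\exists\beta: Cv+D\beta\leq_{\mathbf L}b\}\qquad[\mathbf K,\mathbf L\in\mathcal K].$$ Let $\psi:\mathcal U\times\mathcal V\to\mathbb R$ be a continuously differentiable convex-concave function admitting a representation $$\psi(u,v)=\inf_{f,\tau,\xi}\{f^Tv+\tau: Pf+\tau p+Q\xi+Ru\leq_{\mathbf M}c\}\quad\forall u\in\mathcal U,\ v\in\mathcal V\qquad[\mathbf M\in\mathcal K]$$ such that the conic constraint $Pf+\tau p+Q\xi\leq_{\mathbf M}c-Ru$ in variables $f,\tau,\xi$ is essentially strictly feasible for every $u\in\mathcal U$. Let $$F(u,v)=[\nabla_u\psi(u,v);-\nabla_v\psi(u,v)]:\ \mathcal X:=\mathcal U\times\mathcal V\to E:=\mathbb R^{n_u}\times\mathbb R^{n_v}$$ be the associated (monotone) vector field. Then: (i) The set $$\mathcal Z=\left\{(t\in\mathbb R,\ g=[h;e]\in E,\ x=[u;v]\in\mathcal X):\exists r,s:\ \begin{array}{l} r>\max_{\zeta\in\mathcal V}[\zeta^Te+\psi(u,\zeta)],\\ s>\max_{\omega\in\mathcal U}[\omega^Th-\psi(\omega,v)],\\ t\geq r+s\end{array}\right\}$$ satisfies $\mathcal Z\subset\mathcal F[F,\mathcal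 X]$, and $[t;g;x]\in\mathcal Z$ whenever $x\in\mathcal X$, $g=F(x)$, $t>x^TF(x)$. (ii) $\mathcal Z$ is the projection on the space of $(t,g=[h;e],x=[u;v])$-variables of the solution set of the conic constraint $$\left[\begin{array}{l} t\geq r+s,\ r\geq\theta+\gamma^Tb+\tau,\ s\geq\theta'+c^T\delta+a^T\epsilon,\\ Au+B\alpha\leq_{\mathbf K}a,\ Cv+D\beta\leq_{\mathbf L}b,\ Pf+\tau p+Q\xi+Ru\leq_{\mathbf M}c,\\ C^T\gamma=f+e,\ D^T\gamma=0,\ P^T\delta+v=0,\ p^T\delta=-1,\ Q^T\delta=0,\ R^T\delta+A^T\epsilon=h,\ B^T\epsilon=0,\\ \gamma\geq_{\mathbf L^*}0,\ \delta\geq_{\mathbf M^*}0,\ \epsilon\geq_{\mathbf K^*}0,\ \eta\geq0,\ \theta\geq0,\ \eta\theta\geq1,\ \eta'\geq0,\ \theta'\geq0,\ \eta'\theta'\geq1\end{array}\right]$$ in variables $t,g=[h;e],x=[u;v],r,s,f,\tau,\xi,\alpha,\beta,\gamma,\eta,\theta,\delta,\epsilon,\eta',\theta'$. Consequently, this conic constraint is an almost $\mathcal K$-representation of $(F,\mathcal X)$.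
   Context: $\mathcal K$ is a fixed family of regular cones (closed, convex, pointed, with nonempty interior) in Euclidean spaces which contains $\mathbb R_+$, is closed under finite direct products, and is closed under passing from a cone $\mathbf K$ to its dual $\mathbf K^*$. $a\leq_{\mathbf K}b$ means $b-a\in\mathbf K$. $[a;b]$ denotes vertical concatenation. A $\mathcal K$-conic constraint is a constraint $Ax\leq_{\mathbf K}a$ with $\mathbf K\in\mathcal K$; finite systems of such constraints, linear equalities and nonstrict linear inequalities are equivalent to a single such constraint. The 3D Lorentz cone is $\{x\in\mathbb R^3:x_3\geq\sqrt{x_1^2+x_2^2}\}$ (the constraints $\eta\geq0,\theta\geq0,\eta\theta\geq1$ are expressible through it). A conic constraint $Ax\leq_{\mathbf K}a$ is essentially strictly feasible if $\mathbf K=\mathbb R^m_+\times\mathbf N$ with regular $\mathbf N$ (either factor may be absent), so that it reads $Px\leq p$, $Qx\leq_{\mathbf N}q$, and there is $\bar x$ with $P\bar x\leq p$ and $q-Q\bar x\in\operatorname{int}\mathbf N$; for a representation of a set this refers to the representing constraint in all its variables. Convex-concave means convex in $u$ and concave in $v$. Continuous differentiability of $\psi$ on $\mathcal X=\mathcal U\times\mathcal V$: there is a continuous gradient field $[\nabla_u\psi;\nabla_v\psi]$ on $\mathcal X$ providing the first-order expansion of $\psi$ along $\mathcal X$ at every point of $\mathcal X$. Let $\mathcal X$ be a nonempty convex subset of a Euclidean space $E$. A vector field $F:\mathcal X\to E$ is monotone if $\langle F(x)-F(y),x-y\rangle\geq0$ for all $x,y\in\mathcal X$. For continuous monotone $F$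 put $$\mathcal F[F,\mathcal X]=\{[t;g;x]\in\mathbb R\times E\times E: x\in\mathcal X,\ t-\langle g,y\rangle\geq\langle F(y),x-y\rangle\ \forall y\in\mathcal X\}.$$ A conic constraint $Xx+Gg+tT+Uu\leq_{\mathbf K}a$, $\mathbf K\in\mathcal K$ (or an equivalent finite system), in variables $t,g,x$ and additional variables $u$, with projection $\mathcal T$ of its solution set on the space of $[t;g;x]$, is an almost $\mathcal K$-representation of $(F,\mathcal X)$ if (i) $\mathcal T\subset\mathcal F[F,\mathcal X]$ and $[t;g;x]\in\mathcal T$, $t'\geq t$ imply $[t';g;x]\in\mathcal T$; and (ii') $\mathcal T\supset\{[t;F(x);x]:x\in\mathcal X,\ t>\langle F(x),x\rangle\}$. *)

theory Defs
  imports "HOL-Analysis.Analysis"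
begin

section \<open>Cones in the coordinate spaces of arbitrary dimension\<close>

text \<open>
  A family of cones lives in infinitely many spaces of different dimensions, so its members cannot be
  sets over one type of vectors. The members are therefore taken in coordinates: a point of the
  \<open>n\<close>-dimensional coordinate space is a list of length \<open>n\<close>, concatenation of vectors is concatenation
  of lists, and closedness and interior refer to the Euclidean distance.
\<close>

definition coord_space :: "nat \<Rightarrow> real list set" where
  "coord_space n = {x. length x = n}"

definition list_dist :: "real list \<Rightarrow> real list \<Rightarrow> real" where
  "list_dist x y = L2_set (\<lambda>i. x ! i - y ! i) {..<length x}"

definition list_inner :: "real list \<Rightarrow> real list \<Rightarrow> real" where
  "list_inner x y = sum_list (map2 (*) x y)"

definition list_interior :: "nat \<Rightarrow> real list set \<Rightarrow> real list set" where
  "list_interior n K = {x \<in> coord_space n. \<exists>\<epsilon>>0. \<forall>y\<in>coord_space n. list_dist x y < \<epsilon> \<longrightarrow> y \<in> K}"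

definition list_closed :: "nat \<Rightarrow> real list set \<Rightarrow> bool" where
  "list_closed n K \<longleftrightarrow> (\<forall>x\<in>coord_space n. (\<forall>\<epsilon>>0. \<exists>y\<in>K. list_dist x y < \<epsilon>) \<longrightarrow> x \<in> K)"

definition regular_cone :: "nat \<Rightarrow> real list set \<Rightarrow> bool" where
  "regular_cone n K \<longleftrightarrow>
     K \<subseteq> coord_space n \<and>
     (\<forall>x\<in>K. \<forall>s\<ge>0. map ((*) s) x \<in> K) \<and>
     (\<forall>x\<in>K. \<forall>y\<in>K. \<forall>s\<in>{0..1}. map2 (+) (map ((*) (1 - s)) x) (map ((*) s) y) \<in> K) \<and>
     list_closed n K \<and>
     (\<forall>x\<in>K. map uminus x \<in> K \<longrightarrow> x = replicate n 0) \<and>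
     list_interior n K \<noteq> {}"

definition nonneg_orthant :: "nat \<Rightarrow> real list set" where
  "nonneg_orthant n = {x \<in> coord_space n. \<forall>\<xi>\<in>set x. 0 \<le> \<xi>}"

definition lorentz_cone3 :: "real list set" where
  "lorentz_cone3 = {[x, y, z] | x y z. sqrt (x\<^sup>2 + y\<^sup>2) \<le> z}"

definition cone_prod :: "real list set \<Rightarrow> real list set \<Rightarrow> real list set" where
  "cone_prod K L = {x @ y | x y. x \<in> K \<and> y \<in> L}"

text \<open>The dimension of the ambient space is read off from the (nonempty) cone itself.\<close>

definition list_dual_cone :: "real list set \<Rightarrow> real list set" where
  "list_dual_cone K = {y. \<forall>x\<in>K. length y = length x \<and> 0 \<le> list_inner x y}"

definition cone_family :: "real list set set \<Rightarrow> bool" where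
  "cone_family \<K> \<longleftrightarrow>
     (\<forall>K\<in>\<K>. \<exists>n. regular_cone n K) \<and>
     nonneg_orthant 1 \<in> \<K> \<and>
     (\<forall>K\<in>\<K>. \<forall>L\<in>\<K>. cone_prod K L \<in> \<K>) \<and>
     (\<forall>K\<in>\<K>. list_dual_cone K \<in> \<K>)"

section \<open>Cones and conic constraints in a space of fixed dimension\<close>

text \<open>
  The coordinates of a vector are listed in increasing order of the index; a cone in \<open>real ^ 'k\<close>
  belongs to a family iff its image under \<open>coords\<close> does.
\<close>

definition coords :: "real ^ ('k::{finite,linorder}) \<Rightarrow> real list" where
  "coords x = map (\<lambda>i. x $ i) (sorted_list_of_set UNIV)"

definition cone_le :: "'a::real_vector \<Rightarrow> 'a set \<Rightarrow> 'a \<Rightarrow> bool"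
    ("(_/ \<preceq>\<^bsub>_\<^esub> _)" [51, 0, 51] 50) where
  "x \<preceq>\<^bsub>K\<^esub> y \<longleftrightarrow> y - x \<in> K"

definition dual_cone :: "'a::real_inner set \<Rightarrow> 'a set" where
  "dual_cone K = {y. \<forall>x\<in>K. 0 \<le> x \<bullet> y}"

text \<open>
  Essential strict feasibility of the constraint \<open>A z \<preceq> a\<close> with respect to \<open>K\<close>: the first \<open>m\<close>
  coordinates of \<open>a - A z\<close> carry the linear inequalities, the remaining \<open>n\<close> the cone \<open>N\<close>.
  An absent factor is the case \<open>m = 0\<close> or \<open>n = 0\<close>.
\<close>

definition ess_strictly_feasible ::
    "('z \<Rightarrow> real ^ ('k::{finite,linorder})) \<Rightarrow> (real, 'k) vec set \<Rightarrow> (real, 'k) vec \<Rightarrow> bool" where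
  "ess_strictly_feasible A K a \<longleftrightarrow>
     (\<exists>m n N. regular_cone n N \<and> coords ` K = cone_prod (nonneg_orthant m) N \<and>
        (\<exists>z. take m (coords (a - A z)) \<in> nonneg_orthant m \<and>
             drop m (coords (a - A z)) \<in> list_interior n N))"

text \<open>
  Solution sets of single conic constraints over the family, in a variable \<open>z\<close>
  (usually a tuple): \<open>rows\<close> is the list of rows of the constraint matrix.
\<close>

definition is_conic_solution_set :: "real list set set \<Rightarrow> 'z::real_inner set \<Rightarrow> bool" where
  "is_conic_solution_set \<K> S \<longleftrightarrow>
     (\<exists>N\<in>\<K>. \<exists>rows a. length rows = length a \<and>
        S = {z. map2 (\<lambda>row \<alpha>. \<alpha> - row \<bullet> z) rows a \<in> N})"

section \<open>Monotone vector fields and their almost representations\<close>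

definition monotone_field :: "'e::real_inner set \<Rightarrow> ('e \<Rightarrow> 'e) \<Rightarrow> bool" where
  "monotone_field X F \<longleftrightarrow> (\<forall>x\<in>X. \<forall>y\<in>X. 0 \<le> (F x - F y) \<bullet> (x - y))"

definition calF :: "('e::real_inner \<Rightarrow> 'e) \<Rightarrow> 'e set \<Rightarrow> (real \<times> 'e \<times> 'e) set" where
  "calF F X = {(t, g, x). x \<in> X \<and> (\<forall>y\<in>X. t - g \<bullet> y \<ge> F y \<bullet> (x - y))}"

definition proj_tgx :: "(real \<times> 'e \<times> 'e \<times> 'w) set \<Rightarrow> (real \<times> 'e \<times> 'e) set" where
  "proj_tgx S = {(t, g, x). \<exists>w. (t, g, x, w) \<in> S}"

text \<open>
  \<open>S\<close> is the solution set, in the variables \<open>t, g, x\<close> and the additional variables \<open>w\<close>, of the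
  constraint; a finite system is admitted via the single conic constraint equivalent to it.
\<close>

definition almost_representation ::
    "real list set set \<Rightarrow> ('e::euclidean_space \<Rightarrow> 'e) \<Rightarrow> 'e set \<Rightarrow>
     (real \<times> 'e \<times> 'e \<times> 'w::euclidean_space) set \<Rightarrow> bool" where
  "almost_representation \<K> F X S \<longleftrightarrow>
     X \<noteq> {} \<and> convex X \<and> continuous_on X F \<and> monotone_field X F \<and>
     is_conic_solution_set \<K> S \<and>
     proj_tgx S \<subseteq> calF F X \<and>
     (\<forall>t t' g x. (t, g, x) \<in> proj_tgx S \<and> t' \<ge> t \<longrightarrow> (t', g, x) \<in> proj_tgx S) \<and>
     {(t, F x, x) | t x. x \<in> X \<and> t > F x \<bullet> x} \<subseteq> proj_tgx S"

section \<open>Convex-concave functions\<close>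

definition convex_concave ::
    "'u::real_vector set \<Rightarrow> 'v::real_vector set \<Rightarrow> ('u \<Rightarrow> 'v \<Rightarrow> real) \<Rightarrow> bool" where
  "convex_concave U V \<psi> \<longleftrightarrow>
     (\<forall>v\<in>V. convex_on U (\<lambda>u. \<psi> u v)) \<and> (\<forall>u\<in>U. concave_on V (\<lambda>v. \<psi> u v))"

definition continuous_gradient_field ::
    "('e::real_inner \<Rightarrow> real) \<Rightarrow> 'e set \<Rightarrow> ('e \<Rightarrow> 'e) \<Rightarrow> bool" where
  "continuous_gradient_field f X G \<longleftrightarrow>
     continuous_on X G \<and> (\<forall>x\<in>X. (f has_derivative (\<lambda>d. G x \<bullet> d)) (at x within X))"

text \<open>From the gradient field \<open>G = [\<nabla>\<^sub>u\<psi>; \<nabla>\<^sub>v\<psi>]\<close> to \<open>[\<nabla>\<^sub>u\<psi>; -\<nabla>\<^sub>v\<psi>]\<close>.\<close>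

definition saddle_field :: "('u \<times> 'v \<Rightarrow> 'u \<times> 'v::uminus) \<Rightarrow> 'u \<times> 'v \<Rightarrow> 'u \<times> 'v" where
  "saddle_field G x = (fst (G x), - snd (G x))"

text \<open>
  The suprema are attained maxima when \<open>U\<close>, \<open>V\<close> are nonempty and compact and \<open>\<psi>\<close> is continuous.
\<close>

definition saddle_Z ::
    "'u::real_inner set \<Rightarrow> 'v::real_inner set \<Rightarrow> ('u \<Rightarrow> 'v \<Rightarrow> real) \<Rightarrow>
     (real \<times> ('u \<times> 'v) \<times> ('u \<times> 'v)) set" where
  "saddle_Z U V \<psi> = {(t, (h, e), (u, v)). u \<in> U \<and> v \<in> V \<and>
     (\<exists>r s. r > (SUP \<zeta>\<in>V. \<zeta> \<bullet> e + \<psi> u \<zeta>) \<and>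
            s > (SUP \<omega>\<in>U. \<omega> \<bullet> h - \<psi> \<omega> v) \<and>
            t \<ge> r + s)}"

definition saddle_system ::
    "real^'nu^'k \<Rightarrow> real^'na^'k \<Rightarrow> (real^'k) set \<Rightarrow> real^'k \<Rightarrow>
     real^'nv^'l \<Rightarrow> real^'nb^'l \<Rightarrow> (real^'l) set \<Rightarrow> real^'l \<Rightarrow>
     real^'nv^'m \<Rightarrow> real^'m \<Rightarrow> real^'nx^'m \<Rightarrow> real^'nu^'m \<Rightarrow> (real^'m) set \<Rightarrow> real^'m \<Rightarrow>
     (real \<times> ((real^'nu) \<times> (real^'nv)) \<times> ((real^'nu) \<times> (real^'nv)) \<times>
      real \<times> real \<times> (real^'nv) \<times> real \<times> (real^'nx) \<times> (real^'na) \<times> (real^'nb) \<times>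
      (real^'l) \<times> real \<times> real \<times> (real^'m) \<times> (real^'k) \<times> real \<times> real) set" where
  "saddle_system A B K a C D L b P p Q R M c =
     {(t, (h, e), (u, v), r, s, f, \<tau>, \<xi>, \<alpha>, \<beta>, \<gamma>, \<eta>, \<theta>, \<delta>, \<epsilon>, \<eta>', \<theta>').
        t \<ge> r + s \<and>
        r \<ge> \<theta> + \<gamma> \<bullet> b + \<tau> \<and>
        s \<ge> \<theta>' + c \<bullet> \<delta> + a \<bullet> \<epsilon> \<and>
        A *v u + B *v \<alpha> \<preceq>\<^bsub>K\<^esub> a \<and>
        C *v v + D *v \<beta> \<preceq>\<^bsub>L\<^esub> b \<and>
        P *v f + \<tau> *\<^sub>R p + Q *v \<xi> + R *v u \<preceq>\<^bsub>M\<^esub> c \<and>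
        transpose C *v \<gamma> = f + e \<and>
        transpose D *v \<gamma> = 0 \<and>
        transpose P *v \<delta> + v = 0 \<and>
        p \<bullet> \<delta> = - 1 \<and>
        transpose Q *v \<delta> = 0 \<and>
        transpose R *v \<delta> + transpose A *v \<epsilon> = h \<and>
        transpose B *v \<epsilon> = 0 \<and>
        0 \<preceq>\<^bsub>dual_cone L\<^esub> \<gamma> \<and>
        0 \<preceq>\<^bsub>dual_cone M\<^esub> \<delta> \<and>
        0 \<preceq>\<^bsub>dual_cone K\<^esub> \<epsilon> \<and>
        \<eta> \<ge> 0 \<and> \<theta> \<ge> 0 \<and> \<eta> * \<theta> \<ge> 1 \<and>
        \<eta>' \<ge> 0 \<and> \<theta>' \<ge> 0 \<and> \<eta>' * \<theta>' \<ge> 1}"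

end

(*
  Z is contained in F[F, X] by the gradient inequalities for psi in u and in v, and [t; F(x); x] is in Z
  because, for g = F(x), the two maxima are attained at v and at u.
  The conic system is the dual description of the two maxima. For max over zeta of
  zeta.e + psi(u, zeta), separating the pairs (f, tau) from the affine functions that are small on the
  compact set V yields one (f, tau) that works for all zeta; duality over V then yields gamma. For max
  over omega of omega.h - psi(omega, v), one application of conic duality to the joint problem in
  omega, alpha, f, tau, xi yields delta and epsilon. The strict inequalities become theta > 0, which is
  encoded by eta theta >= 1.
*)
theory Submission
  imports Defs
begin

section \<open>Conic duality\<close>

text \<open>Essential strict feasibility gives no interior point for the polyhedral factor of a
  cone, so separating over the whole cone could yield a normal vector with zero weight on the
  objective. The half-spaces are therefore kept as explicit constraints while the other factor is
  separated off, and the linear problem that remains has an attained dual because finitely generated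
  cones are closed. The two maxima differ in where the infimum defining psi sits. In the first it
  lies under a maximum and need not be attained, so the certificate is built at a level strictly
  between the supremum and \<open>r\<close>. In the second, -psi(omega, v) is itself a supremum,
  which merges with the maximum over omega, and duality is exact at the supremum. The Slater point
  of that merged problem is found in two stages: one for U, then one for the constraint of psi at
  the resulting u. The strictness kept in \<open>saddle_Z\<close> is also the reason why the
  representation is only an almost one: for g = F(x) the two maxima sum to exactly x.F(x), a value
  of t that \<open>saddle_Z\<close> excludes.\<close>

lemma convex_cone_dual_cone: "convex_cone (dual_cone K)"
  by (auto simp: convex_cone_iff dual_cone_def inner_right_distrib)

lemma convex_cone_linear_inequalities: "convex_cone {y. \<forall>w\<in>W. 0 \<le> w \<bullet> y}"
  by (auto simp: convex_cone_iff inner_right_distrib)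

text \<open>A cone with finitely many generators is closed, so no interior point is needed. If
  \<open>(c, d)\<close> lay outside it, the separating vector would yield either an improving
  recession direction or a feasible point of value above \<open>d\<close>.\<close>

lemma affine_farkas:
  fixes A :: "'z::euclidean_space \<Rightarrow> 'y::euclidean_space"
  assumes A: "linear A" and W: "finite W"
    and feasible: "\<And>w. w \<in> W \<Longrightarrow> 0 \<le> w \<bullet> (a - A z0)"
    and bound: "\<And>z. (\<And>w. w \<in> W \<Longrightarrow> 0 \<le> w \<bullet> (a - A z)) \<Longrightarrow> c \<bullet> z \<le> d"
  obtains y where "y \<in> dual_cone {y. \<forall>w\<in>W. 0 \<le> w \<bullet> y}" "adjoint A y = c" "y \<bullet> a \<le> d"
proof -
  note adj = adjoint_clauses[OF A]
  have lin_adj: "linear (adjoint A)"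
    by (rule adjoint_linear[OF A])
  \<comment> \<open>The generator \<open>(0, 1)\<close> provides the slack in
    \<open>y \<bullet> a \<le> d\<close>. The pairs in \<open>?T\<close> are those that some dual
    vector certifies; since they form a convex cone, checking the generators is enough.\<close>
  define S where "S = insert (0, 1) ((\<lambda>w. (adjoint A w, w \<bullet> a)) ` W)"
  let ?T = "{(x, s). \<exists>y\<in>dual_cone {y. \<forall>w\<in>W. 0 \<le> w \<bullet> y}. adjoint A y = x \<and> y \<bullet> a \<le> s}"
  have "\<exists>y\<in>dual_cone {y. \<forall>w\<in>W. 0 \<le> w \<bullet> y}. adjoint A y = 0 \<and> y \<bullet> a \<le> 1"
    by (rule bexI[of _ 0]) (auto simp: dual_cone_def linear_0[OF lin_adj])
  moreover have "w \<in> dual_cone {y. \<forall>w\<in>W. 0 \<le> w \<bullet> y}" if "w \<in> W" for w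
    using that by (auto simp: dual_cone_def inner_commute)
  ultimately have "S \<subseteq> ?T"
    unfolding S_def by fastforce
  moreover have "convex_cone ?T"
  proof -
    have D: "convex_cone (dual_cone {y. \<forall>w\<in>W. 0 \<le> w \<bullet> y})"
      by (rule convex_cone_dual_cone)
    have "\<exists>y\<in>dual_cone {y. \<forall>w\<in>W. 0 \<le> w \<bullet> y}. adjoint A y = adjoint A y1 + adjoint A y2 \<and> y \<bullet> a \<le> s1 + s2"
      if "y1 \<in> dual_cone {y. \<forall>w\<in>W. 0 \<le> w \<bullet> y}" "y2 \<in> dual_cone {y. \<forall>w\<in>W. 0 \<le> w \<bullet> y}"
        "y1 \<bullet> a \<le> s1" "y2 \<bullet> a \<le> s2" for y1 y2 s1 s2
      using convex_cone_add[OF D that(1,2)] that(3,4)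
      by (intro bexI[of _ "y1 + y2"]) (auto simp: linear_add[OF lin_adj] inner_left_distrib)
    moreover have "\<exists>y\<in>dual_cone {y. \<forall>w\<in>W. 0 \<le> w \<bullet> y}. adjoint A y = r *\<^sub>R adjoint A y1 \<and> y \<bullet> a \<le> r * s1"
      if "y1 \<in> dual_cone {y. \<forall>w\<in>W. 0 \<le> w \<bullet> y}" "y1 \<bullet> a \<le> s1" "0 \<le> r" for y1 s1 r
      using convex_cone_scaleR[OF D that(3,1)] that(2,3)
      by (intro bexI[of _ "r *\<^sub>R y1"]) (auto simp: linear_cmul[OF lin_adj] mult_left_mono)
    moreover have "\<exists>y\<in>dual_cone {y. \<forall>w\<in>W. 0 \<le> w \<bullet> y}. adjoint A y = 0 \<and> y \<bullet> a \<le> 0"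
      using convex_cone_contains_0[OF D] by (intro bexI[of _ 0]) (auto simp: linear_0[OF lin_adj])
    ultimately show ?thesis
      unfolding convex_cone_iff by (auto simp: zero_prod_def)
  qed
  ultimately have hull: "convex_cone hull S \<subseteq> ?T"
    by (rule hull_minimal)
  have "(c, d) \<in> convex_cone hull S"
  proof (rule ccontr)
    assume out: "(c, d) \<notin> convex_cone hull S"
    have "closed (convex_cone hull S)"
      by (rule closed_convex_cone_hull) (simp add: S_def W)
    from separating_hyperplane_closed_point[OF convex_convex_cone_hull this out]
    obtain q \<beta> where q: "q \<bullet> (c, d) < \<beta>" "\<And>x. x \<in> convex_cone hull S \<Longrightarrow> \<beta> < q \<bullet> x"
      by blast
    obtain x \<sigma> where x: "q = (x, \<sigma>)" by (cases q)
    have \<beta>: "\<beta> < 0"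
      using q(2)[OF convex_cone_hull_contains_0] by simp
    have nonneg: "0 \<le> q \<bullet> s" if "s \<in> S" for s
    proof (rule ccontr)
      assume neg: "\<not> 0 \<le> q \<bullet> s"
      \<comment> \<open>This multiple of \<open>s\<close> attains exactly the value \<beta>, which
        every point of the hull has to exceed.\<close>
      define r where "r = \<beta> / (q \<bullet> s)"
      have "r \<ge> 0" using neg \<beta> by (simp add: r_def divide_nonpos_neg)
      then have "r *\<^sub>R s \<in> convex_cone hull S"
        using that by (simp add: convex_cone_hull_mul hull_inc)
      from q(2)[OF this] neg show False by (simp add: r_def)
    qed
    have \<sigma>: "0 \<le> \<sigma>"
      using nonneg[of "(0, 1)"] by (simp add: S_def x)
    have w: "0 \<le> w \<bullet> A x + \<sigma> * (w \<bullet> a)" if "w \<in> W" for w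
      using nonneg[of "(adjoint A w, w \<bullet> a)"] that by (simp add: S_def x adj inner_commute)
    have cx: "c \<bullet> x + \<sigma> * d < 0"
      using q(1) \<beta> by (simp add: x inner_commute mult.commute)
    show False
    proof (cases "\<sigma> = 0")
      case True
      \<comment> \<open>Here \<open>- x\<close> is a recession direction along which the objective
        grows; a step of this length raises it to at least \<open>d + 1\<close>.\<close>
      define s where "s = max 0 ((d - c \<bullet> z0 + 1) / (- (c \<bullet> x)))"
      have s: "s \<ge> 0" by (simp add: s_def)
      have "d - c \<bullet> z0 + 1 \<le> s * - (c \<bullet> x)"
      proof -
        have "(d - c \<bullet> z0 + 1) / (- (c \<bullet> x)) \<le> s" by (simp add: s_def)
        then show ?thesis using cx True by (simp add: field_simps)
      qed
      moreover have "c \<bullet> (z0 - s *\<^sub>R x) \<le> d"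
      proof (rule bound)
        fix w assume "w \<in> W"
        then have "0 \<le> w \<bullet> (a - A z0)" "0 \<le> s * (w \<bullet> A x)"
          using feasible w[of w] True s by auto
        then show "0 \<le> w \<bullet> (a - A (z0 - s *\<^sub>R x))"
          by (simp add: linear_diff[OF A] linear_cmul[OF A] inner_diff_right)
      qed
      ultimately show False by (simp add: inner_diff_right)
    next
      case False
      with \<sigma> have \<sigma>: "0 < \<sigma>" by simp
      \<comment> \<open>Normalizing \<sigma> to 1 turns the inequalities on the generators into
        feasibility of this point.\<close>
      have "c \<bullet> (- (1 / \<sigma>) *\<^sub>R x) \<le> d"
      proof (rule bound)
        fix w assume "w \<in> W"
        from w[OF this] \<sigma> show "0 \<le> w \<bullet> (a - A (- (1 / \<sigma>) *\<^sub>R x))"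
          by (simp add: linear_neg[OF A] linear_cmul[OF A] inner_add_right field_simps)
      qed
      with cx \<sigma> show False by (simp add: field_simps)
    qed
  qed
  with hull show thesis by (auto intro: that)
qed

text \<open>
  The coordinate-free form of essential strict feasibility: the half-spaces given by \<open>W\<close> replace the
  orthant factor of the cone.
\<close>

definition ess_interior_point :: "'y::euclidean_space set \<Rightarrow> 'y \<Rightarrow> bool" where
  "ess_interior_point K y \<longleftrightarrow>
     (\<exists>W N. finite W \<and> convex_cone N \<and> K = {y. \<forall>w\<in>W. 0 \<le> w \<bullet> y} \<inter> N \<and>
        (\<forall>w\<in>W. 0 \<le> w \<bullet> y) \<and> y \<in> interior N)"

lemma ess_interior_point_in: "ess_interior_point K y \<Longrightarrow> y \<in> K"
  unfolding ess_interior_point_def using interior_subset by fastforce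

lemma ess_interior_point_imp_convex_cone: "ess_interior_point K y \<Longrightarrow> convex_cone K"
  unfolding ess_interior_point_def
  using convex_cone_Inter[of "{{y. \<forall>w\<in>_. 0 \<le> w \<bullet> y}, _}"] convex_cone_linear_inequalities by auto

text \<open>Supplies the Slater point of a joint problem over two cones. In coordinates the two
  orthant factors of the product would not be adjacent; half-spaces carry no order and are simply
  padded with 0.\<close>

lemma ess_interior_point_Times:
  assumes "ess_interior_point K x" "ess_interior_point M y"
  shows "ess_interior_point (K \<times> M) (x, y)"
proof -
  obtain W N where 1: "finite W" "convex_cone N" "K = {y. \<forall>w\<in>W. 0 \<le> w \<bullet> y} \<inter> N"
    "\<forall>w\<in>W. 0 \<le> w \<bullet> x" "x \<in> interior N"
    using assms(1) by (auto simp: ess_interior_point_def)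
  obtain W' N' where 2: "finite W'" "convex_cone N'" "M = {y. \<forall>w\<in>W'. 0 \<le> w \<bullet> y} \<inter> N'"
    "\<forall>w\<in>W'. 0 \<le> w \<bullet> y" "y \<in> interior N'"
    using assms(2) by (auto simp: ess_interior_point_def)
  show ?thesis
    unfolding ess_interior_point_def
    by (rule exI[of _ "(\<lambda>w. (w, 0)) ` W \<union> Pair 0 ` W'"], rule exI[of _ "N \<times> N'"])
      (use 1 2 in \<open>auto simp: interior_Times convex_cone_Times ball_Un\<close>)
qed

lemma convex_cone_add_interior:
  fixes N :: "'y::euclidean_space set"
  assumes "convex_cone N" "x \<in> N" "y \<in> interior N"
  shows "x + y \<in> interior N"
proof -
  have "(+) x ` interior N \<subseteq> interior N"
    using assms interior_subset[of N]
    by (intro interior_maximal open_translation) (auto intro: convex_cone_add)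
  with assms(3) show ?thesis by auto
qed

lemma convex_cone_scaleR_interior:
  fixes N :: "'y::euclidean_space set"
  assumes "convex_cone N" "y \<in> interior N" "s > 0"
  shows "s *\<^sub>R y \<in> interior N"
proof -
  have "(*\<^sub>R) s ` interior N \<subseteq> interior N"
    using assms interior_subset[of N]
    by (intro interior_maximal open_scaling) (auto intro: convex_cone_scaleR)
  with assms(2) show ?thesis by auto
qed

text \<open>A small step from \<open>y\<close> against \<open>l\<close> stays in the cone and lowers
  the pairing by a positive amount, so the pairing cannot vanish at \<open>y\<close>.\<close>

lemma dual_cone_pos_interior:
  fixes N :: "'y::euclidean_space set"
  assumes "l \<in> dual_cone N" "l \<noteq> 0" "y \<in> interior N"
  shows "0 < l \<bullet> y"
proof -
  obtain e where e: "e > 0" "cball y e \<subseteq> N"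
    using assms(3) mem_interior_cball by blast
  define y' where "y' = y - (e / norm l) *\<^sub>R l"
  have "y' \<in> N"
    using e assms(2) by (intro subsetD[OF e(2)]) (simp add: y'_def dist_norm)
  then have "0 \<le> l \<bullet> y'"
    using assms(1) by (auto simp: dual_cone_def inner_commute)
  moreover have "0 < (e / norm l) * (l \<bullet> l)"
    using e assms(2) by simp
  ultimately show ?thesis by (simp add: y'_def inner_diff_right)
qed

text \<open>The limits at 0 and at infinity isolate the two coefficients. This removes the open
  slack variables from a separation inequality.\<close>

lemma nonneg_of_nonneg_plus_scaled:
  fixes x y :: real
  assumes "\<And>s. s > 0 \<Longrightarrow> 0 \<le> x + s * y"
  shows "0 \<le> x" "0 \<le> y"
proof -
  show "0 \<le> x"
  proof (rule tendsto_lowerbound)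
    show "((\<lambda>s. x + s * y) \<longlongrightarrow> x) (at_right 0)"
      by (auto intro!: tendsto_eq_intros)
    show "\<forall>\<^sub>F s in at_right 0. 0 \<le> x + s * y"
      using assms by (auto simp: eventually_at_filter)
  qed simp
  show "0 \<le> y"
  proof (rule ccontr)
    assume y: "\<not> 0 \<le> y"
    define s where "s = (\<bar>x\<bar> + 1) / - y"
    have "s > 0" unfolding s_def using y by (intro divide_pos_pos) auto
    moreover have "s * y = - \<bar>x\<bar> - 1" using y by (simp add: s_def)
    ultimately show False using assms[of s] by linarith
  qed
qed

text \<open>
  Only the factor \<open>N\<close> in which the Slater point is interior is dualized by separation; the remaining
  problem has linear constraints only and is covered by the affine Farkas lemma.
\<close>

theorem conic_duality:
  fixes A :: "'z::euclidean_space \<Rightarrow> 'y::euclidean_space"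
  assumes A: "linear A" and slater: "ess_interior_point K (a - A z0)"
    and bound: "\<And>z. a - A z \<in> K \<Longrightarrow> c \<bullet> z \<le> d"
  obtains y where "y \<in> dual_cone K" "\<And>z. y \<bullet> A z = c \<bullet> z" "y \<bullet> a \<le> d"
proof -
  note adj = adjoint_clauses[OF A]
  have lin_adj: "linear (adjoint A)"
    by (rule adjoint_linear[OF A])
  obtain W N where W: "finite W" and N: "convex_cone N" and K: "K = {y. \<forall>w\<in>W. 0 \<le> w \<bullet> y} \<inter> N"
    and z0: "\<And>w. w \<in> W \<Longrightarrow> 0 \<le> w \<bullet> (a - A z0)" "a - A z0 \<in> interior N"
    using slater by (auto simp: ess_interior_point_def)
  define \<Phi> where "\<Phi> = {z. \<forall>w\<in>W. 0 \<le> w \<bullet> (a - A z)}"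
  \<comment> \<open>If 0 were in this set, \<open>\<nu>\<close> would be the cone slack of a
    feasible \<open>z\<close> whose value exceeds \<open>d\<close> by \<open>s\<close>. The linear
    constraints are not relaxed: they stay in \<Phi>.\<close>
  define S where "S = {(A z - a + \<nu>, d - c \<bullet> z + s) | z \<nu> s. z \<in> \<Phi> \<and> \<nu> \<in> interior N \<and> s > 0}"
  have "convex S"
  proof (rule convexI)
    fix x y and l m :: real assume xy: "x \<in> S" "y \<in> S" and lm: "0 \<le> l" "0 \<le> m" "l + m = 1"
    obtain z \<nu> s where 1: "x = (A z - a + \<nu>, d - c \<bullet> z + s)" "z \<in> \<Phi>" "\<nu> \<in> interior N" "s > 0"
      using xy by (auto simp: S_def)
    obtain z' \<nu>' s' where 2: "y = (A z' - a + \<nu>', d - c \<bullet> z' + s')" "z' \<in> \<Phi>" "\<nu>' \<in> interior N" "s' > 0"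
      using xy by (auto simp: S_def)
    have m: "m = 1 - l" using lm by simp
    have "convex N" using N by (simp add: convex_cone_def)
    then have "l *\<^sub>R \<nu> + m *\<^sub>R \<nu>' \<in> interior N"
      using convex_interior 1 2 lm by (meson convexD)
    moreover have "l * s + m * s' > 0"
      using 1 2 lm by (smt (verit) mult_nonneg_nonneg mult_pos_pos)
    moreover have "l *\<^sub>R z + m *\<^sub>R z' \<in> \<Phi>"
    proof -
      have "0 \<le> w \<bullet> (a - A (l *\<^sub>R z + m *\<^sub>R z'))" if w: "w \<in> W" for w
      proof -
        have "a - A (l *\<^sub>R z + m *\<^sub>R z') = l *\<^sub>R (a - A z) + m *\<^sub>R (a - A z')"
          by (simp add: linear_add[OF A] linear_cmul[OF A]) (simp add: m algebra_simps)
        moreover have "0 \<le> w \<bullet> (a - A z)" "0 \<le> w \<bullet> (a - A z')"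
          using w 1 2 by (auto simp: \<Phi>_def)
        ultimately show ?thesis
          using lm by (simp add: inner_right_distrib del: scaleR_diff_right)
      qed
      then show ?thesis by (simp add: \<Phi>_def)
    qed
    moreover have "l *\<^sub>R x + m *\<^sub>R y =
        (A (l *\<^sub>R z + m *\<^sub>R z') - a + (l *\<^sub>R \<nu> + m *\<^sub>R \<nu>'), d - c \<bullet> (l *\<^sub>R z + m *\<^sub>R z') + (l * s + m * s'))"
    proof -
      have "A (l *\<^sub>R z + m *\<^sub>R z') = l *\<^sub>R A z + m *\<^sub>R A z'"
        by (simp add: linear_add[OF A] linear_cmul[OF A])
      then show ?thesis
        by (simp add: 1 2 inner_right_distrib) (simp add: m algebra_simps)
    qed
    ultimately show "l *\<^sub>R x + m *\<^sub>R y \<in> S" unfolding S_def by blast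
  qed
  moreover have "0 \<notin> S"
  proof
    assume "0 \<in> S"
    then obtain z \<nu> s where z: "A z - a + \<nu> = 0" "d - c \<bullet> z + s = 0" "z \<in> \<Phi>" "\<nu> \<in> interior N" "s > 0"
      by (auto simp: S_def zero_prod_def)
    have \<nu>: "\<nu> = a - A z" using z(1) by (simp add: algebra_simps eq_neg_iff_add_eq_0)
    have "a - A z \<in> K"
      using z(3,4) interior_subset[of N] by (auto simp: K \<Phi>_def \<nu>)
    from bound[OF this] z show False by simp
  qed
  ultimately obtain q where q: "q \<noteq> 0" "\<And>x. x \<in> S \<Longrightarrow> 0 \<le> q \<bullet> x"
    using separating_hyperplane_set_0[of S] by blast
  obtain l \<mu> where lm: "q = (l, \<mu>)" by (cases q)
  have main: "0 \<le> l \<bullet> (A z - a) + l \<bullet> \<nu> + \<mu> * (d - c \<bullet> z) + \<mu> * s"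
    if "z \<in> \<Phi>" "\<nu> \<in> interior N" "s > 0" for z \<nu> s
  proof -
    have "(A z - a + \<nu>, d - c \<bullet> z + s) \<in> S" using that by (auto simp: S_def)
    from q(2)[OF this] show ?thesis by (simp add: lm inner_right_distrib algebra_simps)
  qed
  have z0_in: "z0 \<in> \<Phi>" using z0 by (simp add: \<Phi>_def)
  \<comment> \<open>The Slater slack plus a large multiple of \<open>y\<close> is an admissible
    \<open>\<nu>\<close>, and its growth rate is the pairing with \<open>y\<close>.\<close>
  have l_dual: "l \<in> dual_cone N"
  proof -
    have "0 \<le> y \<bullet> l" if "y \<in> N" for y
    proof (rule nonneg_of_nonneg_plus_scaled(2))
      fix s :: real assume s: "s > 0"
      have "s *\<^sub>R y + (a - A z0) \<in> interior N"
        using convex_cone_add_interior[OF N _ z0(2)] convex_cone_scaleR[OF N] s that by simp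
      from main[OF z0_in this, of 1] show "0 \<le> \<mu> * (d - c \<bullet> z0) + \<mu> + s * (y \<bullet> l)"
        by (simp add: inner_right_distrib inner_diff_right inner_commute)
    qed
    then show ?thesis by (simp add: dual_cone_def)
  qed
  have \<mu>_nonneg: "0 \<le> \<mu>"
    by (rule nonneg_of_nonneg_plus_scaled(2)[of "l \<bullet> (A z0 - a) + l \<bullet> (a - A z0) + \<mu> * (d - c \<bullet> z0)"])
      (use main[OF z0_in z0(2)] in \<open>simp add: algebra_simps\<close>)
  \<comment> \<open>Both slacks are shrunk to 0 together, \<open>\<nu>\<close> as a multiple of the
    Slater slack.\<close>
  have key: "0 \<le> l \<bullet> (A z - a) + \<mu> * (d - c \<bullet> z)" if z: "z \<in> \<Phi>" for z
    by (rule nonneg_of_nonneg_plus_scaled(1)[of _ "l \<bullet> (a - A z0) + \<mu>"])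
      (use main[OF z convex_cone_scaleR_interior[OF N z0(2)]] in \<open>simp add: algebra_simps\<close>)
  \<comment> \<open>Interiority of the Slater point in \<open>N\<close> enters here: with \<mu> = 0,
    \<open>key\<close> at \<open>z0\<close> would make the pairing of \<open>l\<close> with the
    Slater slack nonpositive.\<close>
  have "\<mu> \<noteq> 0"
  proof
    assume \<mu>: "\<mu> = 0"
    with q(1) lm have "l \<noteq> 0" by (simp add: zero_prod_def)
    from dual_cone_pos_interior[OF l_dual this z0(2)] key[OF z0_in] \<mu> show False
      by (simp add: inner_diff_right)
  qed
  with \<mu>_nonneg have \<mu>: "0 < \<mu>" by simp
  define l' where "l' = (1 / \<mu>) *\<^sub>R l"
  have l': "l' \<in> dual_cone N"
    using l_dual \<mu> by (auto simp: l'_def dual_cone_def)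
  \<comment> \<open>Once the constraint in \<open>N\<close> is priced by \<open>l'\<close>, the
    Lagrangian is bounded under the linear constraints alone, so \<open>affine_farkas\<close>
    supplies the missing part of the multiplier.\<close>
  have "(c - adjoint A l') \<bullet> z \<le> d - l' \<bullet> a" if "\<And>w. w \<in> W \<Longrightarrow> 0 \<le> w \<bullet> (a - A z)" for z
  proof -
    have "0 \<le> l \<bullet> (A z - a) + \<mu> * (d - c \<bullet> z)" using that by (intro key) (simp add: \<Phi>_def)
    then have "0 \<le> (1 / \<mu>) * (l \<bullet> (A z - a) + \<mu> * (d - c \<bullet> z))" using \<mu> by simp
    also have "\<dots> = l' \<bullet> A z - l' \<bullet> a + (d - c \<bullet> z)"
      using \<mu> by (simp add: l'_def inner_diff_right field_simps)
    finally show ?thesis by (simp add: inner_diff_left adj)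
  qed
  with affine_farkas[OF A W z0(1)] obtain y
    where y: "y \<in> dual_cone {y. \<forall>w\<in>W. 0 \<le> w \<bullet> y}" "adjoint A y = c - adjoint A l'" "y \<bullet> a \<le> d - l' \<bullet> a"
    by blast
  show thesis
  proof (rule that)
    show "y + l' \<in> dual_cone K"
      using y(1) l' by (auto simp: K dual_cone_def inner_right_distrib)
    have "adjoint A (y + l') = c" by (simp add: linear_add[OF lin_adj] y(2))
    then show "(y + l') \<bullet> A z = c \<bullet> z" for z by (metis adj(2))
    show "(y + l') \<bullet> a \<le> d" using y(3) by (simp add: inner_left_distrib)
  qed
qed

section \<open>Cones in coordinates\<close>

lemma length_coords [simp]: "length (coords (x :: real ^ 'k::{finite,linorder})) = CARD('k)"
  by (simp add: coords_def)

lemma coords_nth: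
  "j < CARD('k) \<Longrightarrow> coords (x :: real ^ 'k::{finite,linorder}) ! j = x $ (sorted_list_of_set UNIV ! j)"
  by (simp add: coords_def)

lemma bij_betw_sorted_list_of_UNIV:
  "bij_betw ((!) (sorted_list_of_set (UNIV :: 'k::{finite,linorder} set))) {..<CARD('k)} UNIV"
  by (rule bij_betw_nth) auto

lemma inj_coords: "inj coords"
proof (rule injI)
  fix x y :: "real ^ 'k::{finite,linorder}" assume eq: "coords x = coords y"
  show "x = y"
  proof (rule vec_eq_iff[THEN iffD2], rule allI)
    fix i :: 'k
    have "i \<in> set (sorted_list_of_set UNIV)" by simp
    with eq show "x $ i = y $ i" unfolding coords_def map_eq_conv by blast
  qed
qed

lemma range_coords: "range (coords :: real ^ 'k::{finite,linorder} \<Rightarrow> _) = coord_space CARD('k)"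
proof
  show "coord_space CARD('k) \<subseteq> range (coords :: real ^ 'k::{finite,linorder} \<Rightarrow> _)"
  proof
    fix xs :: "real list" assume xs: "xs \<in> coord_space CARD('k)"
    define x :: "(real, 'k) vec" where
      "x = (\<chi> i. xs ! inv_into {..<CARD('k)} ((!) (sorted_list_of_set UNIV)) i)"
    have "coords x = xs"
    proof (rule nth_equalityI)
      fix j assume "j < length (coords x)"
      then show "coords x ! j = xs ! j"
        using bij_betw_inv_into_left[OF bij_betw_sorted_list_of_UNIV[where ?'k='k], of j]
        by (simp add: coords_nth x_def)
    qed (use xs in \<open>simp add: coord_space_def\<close>)
    then show "xs \<in> range (coords :: (real, 'k) vec \<Rightarrow> _)" by blast
  qed
qed (auto simp: coord_space_def)

lemma coords_scaleR: "coords (s *\<^sub>R x) = map ((*) s) (coords x)"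
  by (simp add: coords_def)

lemma coords_add: "coords (x + y) = map2 (+) (coords x) (coords y)"
  by (simp add: coords_def map2_map_map)

lemma list_inner_coords: "list_inner (coords x) (coords y) = x \<bullet> y"
  by (simp add: list_inner_def coords_def map2_map_map sum_list_distinct_conv_sum_set inner_vec_def)

text \<open>\<open>list_dual_cone\<close> reads the dimension off an element of the cone; for the
  empty set it would contain lists of every length.\<close>

lemma coords_dual_cone:
  assumes "K \<noteq> {}"
  shows "coords ` dual_cone K = list_dual_cone (coords ` K)"
proof
  show "coords ` dual_cone K \<subseteq> list_dual_cone (coords ` K)"
    by (auto simp: dual_cone_def list_dual_cone_def list_inner_coords)
  show "list_dual_cone (coords ` K) \<subseteq> coords ` dual_cone K"
  proof
    fix ys assume ys: "ys \<in> list_dual_cone (coords ` K)"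
    then have "ys \<in> coord_space CARD('a)"
      using assms by (auto simp: list_dual_cone_def coord_space_def)
    then obtain y :: "(real, 'a) vec" where y: "ys = coords y"
      using range_coords by blast
    with ys have "y \<in> dual_cone K"
      by (auto simp: list_dual_cone_def dual_cone_def list_inner_coords)
    with y show "ys \<in> coords ` dual_cone K" by blast
  qed
qed

text \<open>The dropped coordinates only remove nonnegative squares. Hence a ball in the full space
  is carried into the ball that witnesses \<open>list_interior\<close> of the second factor.\<close>

lemma list_dist_drop_coords_le:
  "list_dist (drop m (coords x)) (drop m (coords y)) \<le> dist x y"
proof -
  let ?is = "sorted_list_of_set (UNIV :: 'a set)"
  let ?n = "CARD('a) - m"
  have inj: "inj_on (\<lambda>i. ?is ! (m + i)) {..<?n}"
    by (auto simp: inj_on_def nth_eq_iff_index_eq)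
  have "(\<Sum>i<?n. (drop m (coords x) ! i - drop m (coords y) ! i)\<^sup>2) =
      (\<Sum>i<?n. (x $ (?is ! (m + i)) - y $ (?is ! (m + i)))\<^sup>2)"
    by (rule sum.cong) (auto simp: coords_nth)
  also have "\<dots> = (\<Sum>k\<in>(\<lambda>i. ?is ! (m + i)) ` {..<?n}. (x $ k - y $ k)\<^sup>2)"
    by (simp add: sum.reindex[OF inj])
  also have "\<dots> \<le> (\<Sum>k\<in>UNIV. (x $ k - y $ k)\<^sup>2)"
    by (rule sum_mono2) auto
  finally show ?thesis
    by (simp add: list_dist_def dist_vec_def L2_set_def dist_real_def)
qed

text \<open>The orthant factor is cut out by the half-spaces of the first \<open>m\<close> axis
  vectors in the sorted order of indices; the second factor is pulled back to the whole
  space.\<close>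

lemma ess_strictly_feasible_imp_interior_point:
  assumes "ess_strictly_feasible A K a"
  obtains z where "ess_interior_point K (a - A z)"
proof -
  obtain m n N z where N: "regular_cone n N" and K: "coords ` K = cone_prod (nonneg_orthant m) N"
    and z: "take m (coords (a - A z)) \<in> nonneg_orthant m" "drop m (coords (a - A z)) \<in> list_interior n N"
    using assms by (auto simp: ess_strictly_feasible_def)
  define i :: "nat \<Rightarrow> 'b" where "i = (!) (sorted_list_of_set UNIV)"
  define W where "W = (\<lambda>j. axis (i j) (1::real)) ` {..<m}"
  \<comment> \<open>The cylinder over \<open>N\<close>: interiority in it puts no condition on the
    first \<open>m\<close> coordinates, which may vanish at the Slater point.\<close>
  define N' where "N' = {x :: (real, 'b) vec. drop m (coords x) \<in> N}"
  have m: "m \<le> CARD('b)" and n: "n = CARD('b) - m"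
    using z by (auto simp: nonneg_orthant_def list_interior_def coord_space_def)
  have W: "(\<forall>w\<in>W. 0 \<le> w \<bullet> x) \<longleftrightarrow> take m (coords x) \<in> nonneg_orthant m" for x
  proof -
    have "take m (coords x) \<in> nonneg_orthant m \<longleftrightarrow> (\<forall>j<m. 0 \<le> coords x ! j)"
      using m by (auto simp: nonneg_orthant_def coord_space_def all_set_conv_all_nth)
    also have "\<dots> \<longleftrightarrow> (\<forall>j<m. 0 \<le> x $ i j)"
      using m by (auto simp: coords_nth i_def)
    finally show ?thesis
      by (auto simp: W_def inner_axis')
  qed
  have K_eq: "K = {x. \<forall>w\<in>W. 0 \<le> w \<bullet> x} \<inter> N'"
  proof -
    have "x \<in> K \<longleftrightarrow> take m (coords x) \<in> nonneg_orthant m \<and> drop m (coords x) \<in> N" for x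
    proof -
      have "x \<in> K \<longleftrightarrow> coords x \<in> cone_prod (nonneg_orthant m) N"
        using K inj_image_mem_iff[OF inj_coords] by metis
      also have "\<dots> \<longleftrightarrow> take m (coords x) \<in> nonneg_orthant m \<and> drop m (coords x) \<in> N"
      proof
        assume "coords x \<in> cone_prod (nonneg_orthant m) N"
        then show "take m (coords x) \<in> nonneg_orthant m \<and> drop m (coords x) \<in> N"
          using m by (auto simp: cone_prod_def nonneg_orthant_def coord_space_def min_absorb2)
      next
        assume "take m (coords x) \<in> nonneg_orthant m \<and> drop m (coords x) \<in> N"
        then show "coords x \<in> cone_prod (nonneg_orthant m) N"
          unfolding cone_prod_def by (metis (mono_tags, lifting) append_take_drop_id mem_Collect_eq)
      qed
      finally show ?thesis .
    qed
    with W show ?thesis by (auto simp: N'_def)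
  qed
  have interior: "a - A z \<in> interior N'"
  proof -
    obtain \<epsilon> where \<epsilon>: "\<epsilon> > 0"
      "\<And>y. y \<in> coord_space n \<Longrightarrow> list_dist (drop m (coords (a - A z))) y < \<epsilon> \<Longrightarrow> y \<in> N"
      using z(2) by (auto simp: list_interior_def)
    have "ball (a - A z) \<epsilon> \<subseteq> N'"
    proof
      fix y assume "y \<in> ball (a - A z) \<epsilon>"
      then have "list_dist (drop m (coords (a - A z))) (drop m (coords y)) < \<epsilon>"
        using list_dist_drop_coords_le[of m "a - A z" y] by simp
      then show "y \<in> N'" unfolding N'_def by (auto intro: \<epsilon>(2) simp: coord_space_def n)
    qed
    with \<epsilon>(1) show ?thesis by (auto simp: mem_interior)
  qed
  have "convex_cone N'"
    unfolding convex_cone_def convex_alt conic_def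
  proof (intro conjI ballI allI impI)
    show "N' \<noteq> {}" using interior interior_subset by blast
  next
    fix x y and s :: real assume "x \<in> N'" "y \<in> N'" "0 \<le> s \<and> s \<le> 1"
    then show "(1 - s) *\<^sub>R x + s *\<^sub>R y \<in> N'"
      using N unfolding regular_cone_def N'_def
      by (simp add: coords_add coords_scaleR drop_map drop_zip)
  next
    fix x and s :: real assume "x \<in> N'" "0 \<le> s"
    then show "s *\<^sub>R x \<in> N'"
      using N unfolding regular_cone_def N'_def by (simp add: coords_scaleR drop_map)
  qed
  moreover have "\<forall>w\<in>W. 0 \<le> w \<bullet> (a - A z)" using W z(1) by blast
  moreover have "finite W" by (simp add: W_def)
  ultimately have "ess_interior_point K (a - A z)"
    using interior K_eq unfolding ess_interior_point_def by blast
  then show thesis by (rule that)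
qed

section \<open>Multipliers of matrix constraints\<close>

lemma transpose_mult_inner: "(transpose A *v y) \<bullet> x = y \<bullet> (A *v x)" for A :: "real ^ 'n ^ 'm"
  by (metis dot_lmul_matrix transpose_matrix_vector)

lemma transpose_mult_eqI:
  fixes A :: "real ^ 'n ^ 'm"
  assumes "\<And>x. y \<bullet> (A *v x) = z \<bullet> x"
  shows "transpose A *v y = z"
  using assms by (metis transpose_mult_inner vector_eq_rdot)

lemma dual_cone_le: "y \<in> dual_cone K \<Longrightarrow> b - x \<in> K \<Longrightarrow> y \<bullet> x \<le> y \<bullet> b"
  unfolding dual_cone_def by (drule CollectD, drule (1) bspec) (simp add: inner_commute inner_diff_right)

lemma dual_cone_Times:
  assumes "0 \<in> K" "0 \<in> M"
  shows "dual_cone (K \<times> M) = dual_cone K \<times> dual_cone M"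
  using assms by (fastforce simp: dual_cone_def)

text \<open>Weak duality: \<open>\<gamma>\<close> is orthogonal to the range of \<open>D\<close>, so
  the auxiliary variable drops out.\<close>

lemma conic_multiplier_bound:
  fixes C :: "real ^ 'n ^ 'l" and D :: "real ^ 'b ^ 'l"
  assumes "\<gamma> \<in> dual_cone L" "transpose D *v \<gamma> = 0" "C *v x + D *v \<beta> \<preceq>\<^bsub>L\<^esub> b"
  shows "(transpose C *v \<gamma>) \<bullet> x \<le> \<gamma> \<bullet> b"
proof -
  have "\<gamma> \<bullet> (D *v \<beta>) = 0" using assms(2) by (simp flip: transpose_mult_inner)
  with dual_cone_le[OF assms(1), of b "C *v x + D *v \<beta>"] assms(3) show ?thesis
    unfolding transpose_mult_inner by (simp add: cone_le_def inner_right_distrib)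
qed

text \<open>Strong duality with the auxiliary variable given objective coefficient 0, which becomes
  the equation for \<open>transpose D\<close>.\<close>

lemma conic_multiplier_exists:
  fixes C :: "real ^ 'n ^ ('l::{finite,linorder})" and D :: "(real ^ 'b, 'l) vec"
  assumes feas: "ess_strictly_feasible (\<lambda>(x, \<beta>). C *v x + D *v \<beta>) L b"
    and bound: "\<And>x \<beta>. C *v x + D *v \<beta> \<preceq>\<^bsub>L\<^esub> b \<Longrightarrow> y \<bullet> x \<le> d"
  obtains \<gamma> where "\<gamma> \<in> dual_cone L" "transpose C *v \<gamma> = y" "transpose D *v \<gamma> = 0" "\<gamma> \<bullet> b \<le> d"
proof -
  let ?A = "\<lambda>(x, \<beta>). C *v x + D *v \<beta>"
  have lin: "linear ?A"
    by (rule linearI) (auto simp: matrix_vector_right_distrib scaleR_matrix_vector_assoc[symmetric]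
        matrix_vector_mult_scaleR algebra_simps)
  obtain z0 where z0: "ess_interior_point L (b - ?A z0)"
    by (rule ess_strictly_feasible_imp_interior_point[OF feas])
  have bd: "(y, 0) \<bullet> z \<le> d" if "b - ?A z \<in> L" for z
    using bound[of "fst z" "snd z"] that by (cases z) (simp add: cone_le_def)
  obtain \<gamma> where \<gamma>: "\<gamma> \<in> dual_cone L" "\<And>z. \<gamma> \<bullet> ?A z = (y, 0) \<bullet> z" "\<gamma> \<bullet> b \<le> d"
    using conic_duality[OF lin z0 bd] by blast
  have "transpose C *v \<gamma> = y" "transpose D *v \<gamma> = 0"
    using \<gamma>(2)[of "(_, 0)"] \<gamma>(2)[of "(0, _)"] by (intro transpose_mult_eqI; simp)+
  with \<gamma> that show thesis by blast
qed

section \<open>Solution sets of conic constraints\<close>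

text \<open>
  Unlike in \<open>is_conic_solution_set\<close>, the cone must live in the space of the constraint values, so that
  systems can be concatenated.
\<close>

definition conic_set :: "real list set set \<Rightarrow> 'z::real_inner set \<Rightarrow> bool" where
  "conic_set \<K> S \<longleftrightarrow>
     (\<exists>N\<in>\<K>. \<exists>rows a. length rows = length a \<and> N \<subseteq> coord_space (length a) \<and>
        S = {z. map2 (\<lambda>row \<alpha>. \<alpha> - row \<bullet> z) rows a \<in> N})"

lemma conic_set_imp_solution_set: "conic_set \<K> S \<Longrightarrow> is_conic_solution_set \<K> S"
  unfolding conic_set_def is_conic_solution_set_def by blast

text \<open>Rows are stacked and cones multiplied. Splitting a concatenation back into its parts is
  unambiguous because each cone consists of lists as long as its own right-hand side.\<close>

lemma conic_set_conj:
  assumes \<K>: "cone_family \<K>" and "conic_set \<K> {z. P z}" "conic_set \<K> {z. Q z}"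
  shows "conic_set \<K> {z. P z \<and> Q z}"
proof -
  let ?v = "\<lambda>rows a z. map2 (\<lambda>row \<alpha>. \<alpha> - row \<bullet> z) rows a"
  obtain N r a where 1: "N \<in> \<K>" "length r = length a" "N \<subseteq> coord_space (length a)"
    "{z. P z} = {z. ?v r a z \<in> N}"
    using assms(2) unfolding conic_set_def by blast
  obtain N' r' a' where 2: "N' \<in> \<K>" "length r' = length a'" "N' \<subseteq> coord_space (length a')"
    "{z. Q z} = {z. ?v r' a' z \<in> N'}"
    using assms(3) unfolding conic_set_def by blast
  have "cone_prod N N' \<in> \<K>" using \<K> 1(1) 2(1) by (auto simp: cone_family_def)
  moreover have "cone_prod N N' \<subseteq> coord_space (length (a @ a'))"
    using 1(3) 2(3) by (fastforce simp: cone_prod_def coord_space_def)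
  moreover have "?v (r @ r') (a @ a') z \<in> cone_prod N N' \<longleftrightarrow> P z \<and> Q z" for z
  proof -
    have "?v (r @ r') (a @ a') z = ?v r a z @ ?v r' a' z" using 1(2) by simp
    moreover have "?v r a z @ ?v r' a' z \<in> cone_prod N N' \<longleftrightarrow> ?v r a z \<in> N \<and> ?v r' a' z \<in> N'"
    proof
      assume "?v r a z @ ?v r' a' z \<in> cone_prod N N'"
      then obtain x y where xy: "?v r a z @ ?v r' a' z = x @ y" "x \<in> N" "y \<in> N'"
        by (auto simp: cone_prod_def)
      moreover have "length x = length (?v r a z)"
        using xy(2) 1 by (auto simp: coord_space_def)
      ultimately show "?v r a z \<in> N \<and> ?v r' a' z \<in> N'" by (simp add: append_eq_append_conv)
    qed (auto simp: cone_prod_def)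
    moreover have "?v r a z \<in> N \<longleftrightarrow> P z" "?v r' a' z \<in> N' \<longleftrightarrow> Q z"
      using 1(4) 2(4) by (simp_all add: set_eq_iff)
    ultimately show ?thesis by simp
  qed
  ultimately show ?thesis
    unfolding conic_set_def using 1(2) 2(2)
    by (intro bexI[of _ "cone_prod N N'"] exI[of _ "r @ r'"] exI[of _ "a @ a'"]) auto
qed

section \<open>Affine expressions in the constraint variables\<close>

definition affine_map :: "('z::real_vector \<Rightarrow> 'y::real_vector) \<Rightarrow> bool" where
  "affine_map f \<longleftrightarrow> linear (\<lambda>z. f z - f 0)"

lemma affine_map_linear: "linear f \<Longrightarrow> affine_map f"
  by (simp add: affine_map_def linear_0)

lemma affine_map_ident: "affine_map (\<lambda>z. z)"
  by (simp add: affine_map_linear linear_iff)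

lemma affine_map_const: "affine_map (\<lambda>z. c)"
  by (simp add: affine_map_def linear_iff)

lemma affine_map_add: "affine_map f \<Longrightarrow> affine_map g \<Longrightarrow> affine_map (\<lambda>z. f z + g z)"
  unfolding affine_map_def by (drule (1) linear_compose_add) (simp add: algebra_simps)

lemma affine_map_linear_compose:
  "linear l \<Longrightarrow> affine_map f \<Longrightarrow> affine_map (\<lambda>z. l (f z))"
  unfolding affine_map_def
  by (drule linear_compose[of _ l], assumption) (simp add: linear_diff o_def)

lemma affine_map_uminus: "affine_map f \<Longrightarrow> affine_map (\<lambda>z. - f z)"
  by (rule affine_map_linear_compose[of uminus]) (simp_all add: linear_iff)

lemma affine_map_diff: "affine_map f \<Longrightarrow> affine_map g \<Longrightarrow> affine_map (\<lambda>z. f z - g z)"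
  using affine_map_add[OF _ affine_map_uminus] by fastforce

lemma affine_map_matrix_vector_mult: "affine_map f \<Longrightarrow> affine_map (\<lambda>z. (A :: real ^ 'n ^ 'm) *v f z)"
  by (rule affine_map_linear_compose) auto

lemma affine_map_inner_left: "affine_map f \<Longrightarrow> affine_map (\<lambda>z. c \<bullet> f z)"
  by (rule affine_map_linear_compose) (simp_all add: linear_iff inner_right_distrib)

lemma affine_map_inner_right: "affine_map f \<Longrightarrow> affine_map (\<lambda>z. f z \<bullet> c)"
  using affine_map_inner_left[of f c] by (simp add: inner_commute)

lemma affine_map_scaleR: "affine_map f \<Longrightarrow> affine_map (\<lambda>z. f z *\<^sub>R c)"
  by (rule affine_map_linear_compose[of "\<lambda>s. s *\<^sub>R c"]) (simp_all add: linear_iff scaleR_add_left)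

lemma affine_map_nth: "affine_map f \<Longrightarrow> affine_map (\<lambda>z. f z $ i)"
  by (rule affine_map_linear_compose[of "\<lambda>x. x $ i"]) (simp_all add: linear_iff)

lemma affine_map_fst: "affine_map f \<Longrightarrow> affine_map (\<lambda>z. fst (f z))"
  by (rule affine_map_linear_compose) (simp_all add: linear_fst)

lemma affine_map_snd: "affine_map f \<Longrightarrow> affine_map (\<lambda>z. snd (f z))"
  by (rule affine_map_linear_compose) (simp_all add: linear_snd)

lemmas affine_map_intros = affine_map_const affine_map_ident affine_map_add affine_map_uminus affine_map_diff
  affine_map_matrix_vector_mult affine_map_inner_left affine_map_inner_right affine_map_scaleR
  affine_map_nth affine_map_fst affine_map_snd

lemma conic_set_affine_values:
  fixes fs :: "('z::euclidean_space \<Rightarrow> real) list"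
  assumes N: "N \<in> \<K>" "N \<subseteq> coord_space (length fs)" and fs: "\<And>f. f \<in> set fs \<Longrightarrow> affine_map f"
  shows "conic_set \<K> {z. map (\<lambda>f. f z) fs \<in> N}"
proof -
  \<comment> \<open>\<open>adjoint l 1\<close> is the vector representing a linear functional
    \<open>l\<close>; the minus sign matches the format
    \<open>\<alpha> - row \<bullet> z\<close>.\<close>
  define rows where "rows = map (\<lambda>f. - adjoint (\<lambda>z. f z - f 0) 1) fs"
  have "map2 (\<lambda>row \<alpha>. \<alpha> - row \<bullet> z) rows (map (\<lambda>f. f 0) fs) = map (\<lambda>f. f z) fs" for z
    unfolding rows_def map2_map_map
  proof (rule map_cong[OF refl])
    fix f assume "f \<in> set fs"
    then have "linear (\<lambda>z. f z - f 0)" using fs by (simp add: affine_map_def)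
    from adjoint_clauses(2)[OF this, of 1 z]
    show "f 0 - (- adjoint (\<lambda>z. f z - f 0) 1) \<bullet> z = f z" by simp
  qed
  then show ?thesis
    unfolding conic_set_def using N
    by (intro bexI[of _ N] exI[of _ rows] exI[of _ "map (\<lambda>f. f 0) fs"]) (auto simp: rows_def)
qed

lemma conic_set_affine_cone:
  fixes f :: "'z::euclidean_space \<Rightarrow> real ^ 'k::{finite,linorder}"
  assumes "coords ` K \<in> \<K>" "affine_map f"
  shows "conic_set \<K> {z. f z \<in> K}"
proof -
  have "conic_set \<K> {z. map (\<lambda>g. g z) (map (\<lambda>i z. f z $ i) (sorted_list_of_set UNIV)) \<in> coords ` K}"
    using assms by (intro conic_set_affine_values) (auto simp: coord_space_def affine_map_nth)
  moreover have "map (\<lambda>g. g z) (map (\<lambda>i z. f z $ i) (sorted_list_of_set UNIV)) = coords (f z)" for z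
    by (simp add: coords_def o_def)
  ultimately show ?thesis by (simp add: inj_image_mem_iff[OF inj_coords])
qed

lemma conic_set_le:
  fixes f g :: "'z::euclidean_space \<Rightarrow> real"
  assumes "cone_family \<K>" "affine_map f" "affine_map g"
  shows "conic_set \<K> {z. f z \<le> g z}"
proof -
  have "conic_set \<K> {z. map (\<lambda>f. f z) [\<lambda>z. g z - f z] \<in> nonneg_orthant 1}"
    using assms
    by (intro conic_set_affine_values)
      (auto simp: cone_family_def nonneg_orthant_def affine_map_diff)
  then show ?thesis by (simp add: nonneg_orthant_def coord_space_def)
qed

lemma conic_set_eq:
  fixes f g :: "'z::euclidean_space \<Rightarrow> real"
  assumes "cone_family \<K>" "affine_map f" "affine_map g"
  shows "conic_set \<K> {z. f z = g z}"
proof -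
  have "{z. f z = g z} = {z. f z \<le> g z \<and> g z \<le> f z}" by auto
  with conic_set_conj[OF assms(1) conic_set_le[OF assms] conic_set_le[OF assms(1,3,2)]]
  show ?thesis by simp
qed

lemma conic_set_Ball:
  fixes P :: "'i \<Rightarrow> 'z::euclidean_space \<Rightarrow> bool"
  assumes \<K>: "cone_family \<K>" and "finite I" "\<And>i. i \<in> I \<Longrightarrow> conic_set \<K> {z. P i z}"
  shows "conic_set \<K> {z. \<forall>i\<in>I. P i z}"
  using assms(2,3)
proof (induction I)
  case empty
  \<comment> \<open>Even the whole space has to be presented by a cone of the family;
    \<open>0 \<le> 0\<close> does this.\<close>
  show ?case
    using conic_set_le[OF \<K> affine_map_const affine_map_const, of 0 0] by simp
next
  case (insert i I)
  then show ?case using conic_set_conj[OF \<K>, of "P i"] by simp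
qed

lemma conic_set_vec_eq:
  fixes f g :: "'z::euclidean_space \<Rightarrow> real ^ 'n"
  assumes "cone_family \<K>" "affine_map f" "affine_map g"
  shows "conic_set \<K> {z. f z = g z}"
proof -
  have "conic_set \<K> {z. \<forall>i\<in>UNIV. f z $ i = g z $ i}"
    by (rule conic_set_Ball[OF assms(1) finite_class.finite_UNIV])
      (rule conic_set_eq[OF assms(1) affine_map_nth[OF assms(2)] affine_map_nth[OF assms(3)]])
  moreover have "{z. \<forall>i\<in>UNIV. f z $ i = g z $ i} = {z. f z = g z}"
    by (auto simp: vec_eq_iff)
  ultimately show ?thesis by simp
qed

text \<open>By 4xy = (x + y)^2 - (x - y)^2, the condition xy \<ge> 1 is a norm bound by x + y; a
  positive product with a nonnegative sum forces both factors to be nonnegative.\<close>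

lemma hyperbola_iff_lorentz:
  fixes x y :: real
  shows "0 \<le> x \<and> 0 \<le> y \<and> 1 \<le> x * y \<longleftrightarrow> [x - y, 2, x + y] \<in> lorentz_cone3"
proof -
  have sq: "(x + y)\<^sup>2 - ((x - y)\<^sup>2 + 2\<^sup>2) = 4 * (x * y - 1)"
    by (simp add: power2_eq_square algebra_simps)
  have "sqrt ((x - y)\<^sup>2 + 2\<^sup>2) \<le> x + y \<longleftrightarrow> 0 \<le> x + y \<and> 1 \<le> x * y"
  proof
    assume le: "sqrt ((x - y)\<^sup>2 + 2\<^sup>2) \<le> x + y"
    have "0 \<le> sqrt ((x - y)\<^sup>2 + 2\<^sup>2)" by simp
    with le have "0 \<le> x + y" by linarith
    moreover have "(x - y)\<^sup>2 + 2\<^sup>2 \<le> (x + y)\<^sup>2" using le by (rule sqrt_le_D)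
    ultimately show "0 \<le> x + y \<and> 1 \<le> x * y" using sq by auto
  next
    assume "0 \<le> x + y \<and> 1 \<le> x * y"
    with sq show "sqrt ((x - y)\<^sup>2 + 2\<^sup>2) \<le> x + y"
      by (intro real_le_lsqrt) auto
  qed
  also have "\<dots> \<longleftrightarrow> 0 \<le> x \<and> 0 \<le> y \<and> 1 \<le> x * y"
    by (smt (verit) mult_nonneg_nonpos mult_nonpos_nonneg)
  finally show ?thesis by (simp add: lorentz_cone3_def)
qed

lemma conic_set_hyperbola:
  fixes f g :: "'z::euclidean_space \<Rightarrow> real"
  assumes "lorentz_cone3 \<in> \<K>" "affine_map f" "affine_map g"
  shows "conic_set \<K> {z. 0 \<le> f z \<and> 0 \<le> g z \<and> 1 \<le> f z * g z}"
proof -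
  have "conic_set \<K> {z. map (\<lambda>f. f z) [\<lambda>z. f z - g z, \<lambda>z. 2, \<lambda>z. f z + g z] \<in> lorentz_cone3}"
    using assms
    by (intro conic_set_affine_values)
      (auto simp: lorentz_cone3_def coord_space_def intro: affine_map_intros)
  then show ?thesis by (simp add: hyperbola_iff_lorentz)
qed

text \<open>The three conjuncts form one Lorentz constraint and have to be taken off a right-nested
  conjunction together: the product inequality by itself is not affine.\<close>

lemma conic_set_hyperbola_conj:
  fixes f g :: "'z::euclidean_space \<Rightarrow> real"
  assumes "cone_family \<K>" "lorentz_cone3 \<in> \<K>" "affine_map f" "affine_map g" "conic_set \<K> {z. P z}"
  shows "conic_set \<K> {z. 0 \<le> f z \<and> 0 \<le> g z \<and> 1 \<le> f z * g z \<and> P z}"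
  using conic_set_conj[OF assms(1) conic_set_hyperbola[OF assms(2-4)] assms(5)] by (simp add: conj_assoc)

text \<open>With the variables as arbitrary affine functions of one point \<open>z\<close>, closure
  rules match the constraints directly; the components of the long tuple are substituted
  afterwards.\<close>

lemma conic_set_saddle_constraints:
  fixes A :: "real ^ 'nu ^ ('k::{finite,linorder})" and B :: "(real ^ 'na, 'k) vec"
    and C :: "real ^ 'nv ^ ('l::{finite,linorder})" and D :: "(real ^ 'nb, 'l) vec"
    and P :: "real ^ 'nv ^ ('m::{finite,linorder})"
    and Q :: "(real ^ 'nx, 'm) vec" and R :: "(real ^ 'nu, 'm) vec"
    and t r s \<tau> \<eta> \<theta> \<eta>' \<theta>' :: "'z::euclidean_space \<Rightarrow> real"
  assumes family: "cone_family \<K>" and lorentz: "lorentz_cone3 \<in> \<K>"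
    and cones: "coords ` K \<in> \<K>" "coords ` L \<in> \<K>" "coords ` M \<in> \<K>"
    and nonempty: "K \<noteq> {}" "L \<noteq> {}" "M \<noteq> {}"
    and aff: "affine_map t" "affine_map h" "affine_map e" "affine_map u" "affine_map v"
      "affine_map r" "affine_map s" "affine_map f" "affine_map \<tau>" "affine_map \<xi>"
      "affine_map \<alpha>" "affine_map \<beta>" "affine_map \<gamma>" "affine_map \<eta>" "affine_map \<theta>"
      "affine_map \<delta>" "affine_map \<epsilon>" "affine_map \<eta>'" "affine_map \<theta>'"
  shows "conic_set \<K> {z. 
        t z \<ge> r z + s z \<and>
        r z \<ge> \<theta> z + \<gamma> z \<bullet> b + \<tau> z \<and>
        s z \<ge> \<theta>' z + c \<bullet> \<delta> z + a \<bullet> \<epsilon> z \<and>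
        A *v u z + B *v \<alpha> z \<preceq>\<^bsub>K\<^esub> a \<and>
        C *v v z + D *v \<beta> z \<preceq>\<^bsub>L\<^esub> b \<and>
        P *v f z + \<tau> z *\<^sub>R p + Q *v \<xi> z + R *v u z \<preceq>\<^bsub>M\<^esub> c \<and>
        transpose C *v \<gamma> z = f z + e z \<and>
        transpose D *v \<gamma> z = 0 \<and>
        transpose P *v \<delta> z + v z = 0 \<and>
        p \<bullet> \<delta> z = - 1 \<and>
        transpose Q *v \<delta> z = 0 \<and>
        transpose R *v \<delta> z + transpose A *v \<epsilon> z = h z \<and>
        transpose B *v \<epsilon> z = 0 \<and>
        0 \<preceq>\<^bsub>dual_cone L\<^esub> \<gamma> z \<and>
        0 \<preceq>\<^bsub>dual_cone M\<^esub> \<delta> z \<and>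
        0 \<preceq>\<^bsub>dual_cone K\<^esub> \<epsilon> z \<and>
        \<eta> z \<ge> 0 \<and> \<theta> z \<ge> 0 \<and> \<eta> z * \<theta> z \<ge> 1 \<and>
        \<eta>' z \<ge> 0 \<and> \<theta>' z \<ge> 0 \<and> \<eta>' z * \<theta>' z \<ge> 1}"
proof -
  have duals: "coords ` dual_cone K \<in> \<K>" "coords ` dual_cone L \<in> \<K>" "coords ` dual_cone M \<in> \<K>"
    using family cones nonempty by (simp_all add: coords_dual_cone cone_family_def)
  show ?thesis
    unfolding cone_le_def
    by (rule conic_set_hyperbola_conj[OF family lorentz] conic_set_hyperbola[OF lorentz]
        conic_set_conj[OF family]
        conic_set_le[OF family] conic_set_eq[OF family] conic_set_vec_eq[OF family]
        conic_set_affine_cone[OF cones(1)] conic_set_affine_cone[OF cones(2)]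
        conic_set_affine_cone[OF cones(3)] conic_set_affine_cone[OF duals(1)]
        conic_set_affine_cone[OF duals(2)] conic_set_affine_cone[OF duals(3)]
        aff affine_map_const affine_map_add affine_map_diff affine_map_matrix_vector_mult
        affine_map_inner_left affine_map_inner_right affine_map_scaleR)+
qed

lemma conic_set_saddle_system:
  fixes A :: "real ^ 'nu ^ ('k::{finite,linorder})" and B :: "(real ^ 'na, 'k) vec"
    and C :: "real ^ 'nv ^ ('l::{finite,linorder})" and D :: "(real ^ 'nb, 'l) vec"
    and P :: "real ^ 'nv ^ ('m::{finite,linorder})"
    and Q :: "(real ^ 'nx, 'm) vec" and R :: "(real ^ 'nu, 'm) vec"
  assumes "cone_family \<K>" "lorentz_cone3 \<in> \<K>"
    and "coords ` K \<in> \<K>" "coords ` L \<in> \<K>" "coords ` M \<in> \<K>"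
    and "K \<noteq> {}" "L \<noteq> {}" "M \<noteq> {}"
  shows "conic_set \<K> (saddle_system A B K a C D L b P p Q R M c)"
  unfolding saddle_system_def case_prod_unfold
  by (rule conic_set_saddle_constraints[OF assms]) (intro affine_map_fst affine_map_snd affine_map_ident)+

section \<open>The two maxima\<close>

text \<open>
  The affine functions \<open>\<zeta> \<mapsto> y \<bullet> \<zeta> + s\<close> which are at most \<open>\<rho>\<close> on the compact set form a convex set of
  pairs \<open>(y, s)\<close> with interior; a normal vector separating it from the given family is a point of
  the compact set.
\<close>

lemma compact_bilinear_minimax:
  fixes V :: "'v::euclidean_space set" and \<Phi> :: "('v \<times> real) set"
  assumes V: "compact V" "convex V" "V \<noteq> {}" and \<Phi>: "convex \<Phi>"
    and less: "\<And>\<zeta>. \<zeta> \<in> V \<Longrightarrow> \<exists>(y, s)\<in>\<Phi>. y \<bullet> \<zeta> + s < \<rho>"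
  obtains y s where "(y, s) \<in> \<Phi>" "\<And>\<zeta>. \<zeta> \<in> V \<Longrightarrow> y \<bullet> \<zeta> + s \<le> \<rho>"
proof -
  define T where "T = {(y, s). \<forall>\<zeta>\<in>V. y \<bullet> \<zeta> + s \<le> \<rho>}"
  have "\<Phi> \<inter> T \<noteq> {}"
  proof
    assume disj: "\<Phi> \<inter> T = {}"
    have "convex T"
    proof -
      have "T = (\<Inter>\<zeta>\<in>V. {q. (\<zeta>, 1) \<bullet> q \<le> \<rho>})"
        by (auto simp: T_def inner_commute)
      then show ?thesis by (simp add: convex_INT convex_halfspace_le)
    qed
    moreover have T0: "(0, \<rho>) \<in> T" by (simp add: T_def)
    moreover have "\<Phi> \<noteq> {}" using less V(3) by fastforce
    ultimately obtain q \<beta> where q: "q \<noteq> 0" "\<And>x. x \<in> T \<Longrightarrow> q \<bullet> x \<le> \<beta>" "\<And>x. x \<in> \<Phi> \<Longrightarrow> \<beta> \<le> q \<bullet> x"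
      using separating_hyperplane_sets[OF \<open>convex T\<close> \<Phi>] disj by blast
    obtain z \<kappa> where z: "q = (z, \<kappa>)" by (cases q)
    have qT: "z \<bullet> y + \<kappa> * s \<le> \<beta>" if "(y, s) \<in> T" for y s
      using q(2)[OF that] by (simp add: z)
    obtain B where B: "\<And>\<zeta>. \<zeta> \<in> V \<Longrightarrow> norm \<zeta> \<le> B"
      using compact_imp_bounded[OF V(1)] by (auto simp: bounded_iff)
    \<comment> \<open>On a set bounded by \<open>B\<close>, any slope \<open>y\<close> is
      compensated by lowering the constant by \<open>norm y * B\<close>. So \<open>T\<close>
      contains points with every slope and arbitrarily low constants, which forces \<kappa> >
      0.\<close>
    have in_T: "(y, \<rho> - norm y * B - s) \<in> T" if "s \<ge> 0" for y s
    proof -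
      have "y \<bullet> \<zeta> \<le> norm y * B" if "\<zeta> \<in> V" for \<zeta>
        using norm_cauchy_schwarz[of y \<zeta>] mult_left_mono[OF B[OF that], of "norm y"] by simp
      with that show ?thesis by (fastforce simp: T_def)
    qed
    have "0 \<le> \<kappa>"
    proof (rule ccontr)
      assume neg: "\<not> 0 \<le> \<kappa>"
      define s where "s = (\<bar>\<beta> - \<kappa> * \<rho>\<bar> + 1) / - \<kappa>"
      have "s > 0" unfolding s_def using neg by (intro divide_pos_pos) auto
      then have "0 \<le> s" by simp
      from qT[OF in_T[OF this, of 0]] have "\<kappa> * \<rho> - \<kappa> * s \<le> \<beta>" by (simp add: algebra_simps)
      moreover have "\<kappa> * s = - \<bar>\<beta> - \<kappa> * \<rho>\<bar> - 1" using neg by (simp add: s_def)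
      ultimately show False by linarith
    qed
    moreover have "\<kappa> \<noteq> 0"
    proof
      assume \<kappa>: "\<kappa> = 0"
      with q(1) z have "z \<noteq> 0" by (simp add: zero_prod_def)
      \<comment> \<open>Chosen so that the functional takes the value
        \<open>\<bar>\<beta>\<bar> + 1\<close>, which is above \<beta>.\<close>
      define r where "r = (\<bar>\<beta>\<bar> + 1) / (z \<bullet> z)"
      have "z \<bullet> (r *\<^sub>R z) \<le> \<beta>" using qT[OF in_T[of 0 "r *\<^sub>R z"]] \<kappa> by simp
      then show False using \<open>z \<noteq> 0\<close> by (simp add: r_def)
    qed
    ultimately have \<kappa>: "0 < \<kappa>" by simp
    \<comment> \<open>Normalizing \<kappa> to 1 makes the separating functional the evaluation of
      affine functions at the point \<open>x\<close>.\<close>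
    define x where "x = (1 / \<kappa>) *\<^sub>R z"
    have zx: "z = \<kappa> *\<^sub>R x" using \<kappa> by (simp add: x_def)
    have T': "x \<bullet> y + s \<le> \<beta> / \<kappa>" if "(y, s) \<in> T" for y s
      using qT[OF that] \<kappa> by (simp add: zx field_simps)
    have "x \<in> V"
    proof (rule ccontr)
      assume "x \<notin> V"
      with separating_hyperplane_closed_point[OF V(2) compact_imp_closed[OF V(1)]]
      obtain y \<alpha> where y: "y \<bullet> x < \<alpha>" "\<And>\<zeta>. \<zeta> \<in> V \<Longrightarrow> \<alpha> < y \<bullet> \<zeta>" by blast
      \<comment> \<open>The affine function with slope \<open>- r *\<^sub>R y\<close> and constant
        \<open>\<rho> + r * \<alpha>\<close> is below \<rho> on \<open>V\<close>, yet at
        \<open>x\<close> it exceeds \<rho> by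
        \<open>\<bar>\<beta> / \<kappa> - \<rho>\<bar> + 1\<close>, too much for a member of
        \<open>T\<close>.\<close>
      define r where "r = (\<bar>\<beta> / \<kappa> - \<rho>\<bar> + 1) / (\<alpha> - y \<bullet> x)"
      have r: "r > 0" unfolding r_def using y(1) by (intro divide_pos_pos) auto
      have "(- r *\<^sub>R y, \<rho> + r * \<alpha>) \<in> T"
        using y(2) r by (fastforce simp: T_def)
      from T'[OF this] have "r * (\<alpha> - y \<bullet> x) \<le> \<beta> / \<kappa> - \<rho>"
        by (simp add: algebra_simps inner_commute)
      then show False using y(1) by (simp add: r_def)
    qed
    then obtain y s where ys: "(y, s) \<in> \<Phi>" "y \<bullet> x + s < \<rho>"
      using less by blast
    have "\<rho> \<le> \<beta> / \<kappa>" using T'[OF T0] by simp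
    moreover have "\<beta> / \<kappa> \<le> y \<bullet> x + s"
      using q(3)[OF ys(1)] \<kappa> by (simp add: z zx field_simps inner_commute)
    ultimately show False using ys(2) by simp
  qed
  then show thesis by (auto simp: T_def intro: that)
qed

lemma convex_conic_representation:
  fixes C :: "real ^ 'n ^ 'l" and D :: "real ^ 'b ^ 'l"
  assumes "convex L"
  shows "convex {x. \<exists>\<beta>. C *v x + D *v \<beta> \<preceq>\<^bsub>L\<^esub> b}"
proof (rule convexI, clarify)
  fix x y \<beta> \<beta>' and s t :: real
  assume 1: "C *v x + D *v \<beta> \<preceq>\<^bsub>L\<^esub> b" "C *v y + D *v \<beta>' \<preceq>\<^bsub>L\<^esub> b" and st: "0 \<le> s" "0 \<le> t" "s + t = 1"
  have t: "t = 1 - s" using st by simp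
  have "b - (C *v (s *\<^sub>R x + t *\<^sub>R y) + D *v (s *\<^sub>R \<beta> + t *\<^sub>R \<beta>'))
    = s *\<^sub>R (b - (C *v x + D *v \<beta>)) + t *\<^sub>R (b - (C *v y + D *v \<beta>'))"
    by (simp add: matrix_vector_right_distrib matrix_vector_mult_scaleR) (simp add: t algebra_simps)
  also have "\<dots> \<in> L" using assms 1 st by (simp add: cone_le_def convexD)
  finally show "\<exists>\<beta>. C *v (s *\<^sub>R x + t *\<^sub>R y) + D *v \<beta> \<preceq>\<^bsub>L\<^esub> b"
    by (auto simp: cone_le_def)
qed

text \<open>\<open>le\<close> and \<open>less\<close> express that \<phi> is an infimum, without
  attainment. The certificate is therefore found at an intermediate level \<rho>, and the gap
  \<open>r - \<rho>\<close> becomes \<theta>. The converse is weak duality.\<close>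

lemma SUP_add_less_iff:
  fixes C :: "real ^ 'nv ^ ('l::{finite,linorder})" and D :: "(real ^ 'nb, 'l) vec"
    and P :: "real ^ 'nv ^ 'm" and Q :: "real ^ 'nx ^ 'm" and R :: "real ^ 'nu ^ 'm"
    and \<phi> :: "real ^ 'nv \<Rightarrow> real"
  assumes V: "compact V" "convex V" "V \<noteq> {}" "V = {v. \<exists>\<beta>. C *v v + D *v \<beta> \<preceq>\<^bsub>L\<^esub> b}"
    and feas: "ess_strictly_feasible (\<lambda>(v, \<beta>). C *v v + D *v \<beta>) L b"
    and M: "convex M"
    and le: "\<And>v f \<tau> \<xi>. v \<in> V \<Longrightarrow> P *v f + \<tau> *\<^sub>R p + Q *v \<xi> + R *v u \<preceq>\<^bsub>M\<^esub> c \<Longrightarrow> \<phi> v \<le> f \<bullet> v + \<tau>"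
    and less: "\<And>v \<rho>. v \<in> V \<Longrightarrow> \<phi> v < \<rho> \<Longrightarrow>
      \<exists>f \<tau> \<xi>. P *v f + \<tau> *\<^sub>R p + Q *v \<xi> + R *v u \<preceq>\<^bsub>M\<^esub> c \<and> f \<bullet> v + \<tau> < \<rho>"
    and bdd: "bdd_above ((\<lambda>\<zeta>. \<zeta> \<bullet> e + \<phi> \<zeta>) ` V)"
  shows "(SUP \<zeta>\<in>V. \<zeta> \<bullet> e + \<phi> \<zeta>) < r \<longleftrightarrow>
    (\<exists>\<theta>>0. \<exists>f \<tau> \<xi> \<gamma>. P *v f + \<tau> *\<^sub>R p + Q *v \<xi> + R *v u \<preceq>\<^bsub>M\<^esub> c \<and>
       transpose C *v \<gamma> = f + e \<and> transpose D *v \<gamma> = 0 \<and> \<gamma> \<in> dual_cone L \<and> \<theta> + \<gamma> \<bullet> b + \<tau> \<le> r)"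
    (is "?l \<longleftrightarrow> ?r")
proof
  assume ?l
  then obtain \<rho> where \<rho>: "(SUP \<zeta>\<in>V. \<zeta> \<bullet> e + \<phi> \<zeta>) < \<rho>" "\<rho> < r"
    using dense by blast
  \<comment> \<open>The shift of \<open>f\<close> by \<open>e\<close> absorbs the linear term of the
    maximized function.\<close>
  define \<Phi> where "\<Phi> = {(f + e, \<tau>) | f \<tau> \<xi>. P *v f + \<tau> *\<^sub>R p + Q *v \<xi> + R *v u \<preceq>\<^bsub>M\<^esub> c}"
  have "convex \<Phi>"
  proof (rule convexI)
    fix x y and l m :: real assume xy: "x \<in> \<Phi>" "y \<in> \<Phi>" and lm: "0 \<le> l" "0 \<le> m" "l + m = 1"
    obtain f \<tau> \<xi> where 1: "x = (f + e, \<tau>)" "c - (P *v f + \<tau> *\<^sub>R p + Q *v \<xi> + R *v u) \<in> M"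
      using xy by (auto simp: \<Phi>_def cone_le_def)
    obtain f' \<tau>' \<xi>' where 2: "y = (f' + e, \<tau>')" "c - (P *v f' + \<tau>' *\<^sub>R p + Q *v \<xi>' + R *v u) \<in> M"
      using xy by (auto simp: \<Phi>_def cone_le_def)
    have m: "m = 1 - l" using lm by simp
    have "c - (P *v (l *\<^sub>R f + m *\<^sub>R f') + (l * \<tau> + m * \<tau>') *\<^sub>R p + Q *v (l *\<^sub>R \<xi> + m *\<^sub>R \<xi>') + R *v u)
      = l *\<^sub>R (c - (P *v f + \<tau> *\<^sub>R p + Q *v \<xi> + R *v u))
      + m *\<^sub>R (c - (P *v f' + \<tau>' *\<^sub>R p + Q *v \<xi>' + R *v u))"
      by (simp add: matrix_vector_right_distrib matrix_vector_mult_scaleR) (simp add: m algebra_simps)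
    also have "\<dots> \<in> M" using M 1 2 lm by (meson convexD)
    finally have "(l *\<^sub>R f + m *\<^sub>R f' + e, l * \<tau> + m * \<tau>') \<in> \<Phi>"
      by (auto simp: \<Phi>_def cone_le_def)
    moreover have "l *\<^sub>R x + m *\<^sub>R y = (l *\<^sub>R f + m *\<^sub>R f' + e, l * \<tau> + m * \<tau>')"
      by (simp add: 1 2 m algebra_simps)
    ultimately show "l *\<^sub>R x + m *\<^sub>R y \<in> \<Phi>" by simp
  qed
  moreover have "\<exists>(y, s)\<in>\<Phi>. y \<bullet> \<zeta> + s < \<rho>" if "\<zeta> \<in> V" for \<zeta>
  proof -
    have "\<zeta> \<bullet> e + \<phi> \<zeta> < \<rho>"
      using cSUP_upper[OF that bdd] \<rho>(1) by simp
    then have "\<phi> \<zeta> < \<rho> - \<zeta> \<bullet> e" by simp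
    from less[OF that this] obtain f \<tau> \<xi> where
      "P *v f + \<tau> *\<^sub>R p + Q *v \<xi> + R *v u \<preceq>\<^bsub>M\<^esub> c" "f \<bullet> \<zeta> + \<tau> < \<rho> - \<zeta> \<bullet> e" by blast
    then show ?thesis
      unfolding \<Phi>_def by (intro bexI[of _ "(f + e, \<tau>)"]) (auto simp: inner_right_distrib inner_commute)
  qed
  ultimately obtain y \<tau> where "(y, \<tau>) \<in> \<Phi>" and y: "\<And>\<zeta>. \<zeta> \<in> V \<Longrightarrow> y \<bullet> \<zeta> + \<tau> \<le> \<rho>"
    using compact_bilinear_minimax[OF V(1-3)] by blast
  then obtain f \<xi> where f: "y = f + e" "P *v f + \<tau> *\<^sub>R p + Q *v \<xi> + R *v u \<preceq>\<^bsub>M\<^esub> c"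
    by (auto simp: \<Phi>_def)
  have "y \<bullet> x \<le> \<rho> - \<tau>" if "C *v x + D *v \<beta> \<preceq>\<^bsub>L\<^esub> b" for x \<beta>
    using y[of x] that V(4) by fastforce
  then obtain \<gamma> where "\<gamma> \<in> dual_cone L" "transpose C *v \<gamma> = y" "transpose D *v \<gamma> = 0" "\<gamma> \<bullet> b \<le> \<rho> - \<tau>"
    using conic_multiplier_exists[OF feas] by blast
  with \<rho>(2) f show ?r
    by (intro exI[of _ "r - \<rho>"] conjI exI[of _ f] exI[of _ \<tau>] exI[of _ \<xi>] exI[of _ \<gamma>]) auto
next
  assume ?r
  then obtain \<theta> f \<tau> \<xi> \<gamma> where *: "\<theta> > 0" "P *v f + \<tau> *\<^sub>R p + Q *v \<xi> + R *v u \<preceq>\<^bsub>M\<^esub> c"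
    "transpose C *v \<gamma> = f + e" "transpose D *v \<gamma> = 0" "\<gamma> \<in> dual_cone L" "\<theta> + \<gamma> \<bullet> b + \<tau> \<le> r" by blast
  have "(SUP \<zeta>\<in>V. \<zeta> \<bullet> e + \<phi> \<zeta>) \<le> r - \<theta>"
  proof (rule cSUP_least[OF V(3)])
    fix \<zeta> assume \<zeta>: "\<zeta> \<in> V"
    then obtain \<beta> where "C *v \<zeta> + D *v \<beta> \<preceq>\<^bsub>L\<^esub> b" using V(4) by blast
    from conic_multiplier_bound[OF *(5,4) this] have "(f + e) \<bullet> \<zeta> \<le> \<gamma> \<bullet> b" by (simp only: *(3))
    with le[OF \<zeta> *(2)] *(6) show "\<zeta> \<bullet> e + \<phi> \<zeta> \<le> r - \<theta>"
      by (simp add: inner_right_distrib inner_commute)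
  qed
  with *(1) show ?l by simp
qed

text \<open>Subtracting an infimum adds a supremum, so the problem is one linear maximization. Conic
  duality attains the bound at the supremum \<open>d\<close> itself, and \<theta> is
  \<open>s - d\<close>.\<close>

lemma SUP_diff_less_iff:
  fixes A :: "real ^ 'nu ^ ('k::{finite,linorder})" and B :: "(real ^ 'na, 'k) vec"
    and P :: "real ^ 'nv ^ ('m::{finite,linorder})" and Q :: "(real ^ 'nx, 'm) vec" and R :: "(real ^ 'nu, 'm) vec"
    and \<phi> :: "real ^ 'nu \<Rightarrow> real"
  assumes U: "U \<noteq> {}" "U = {u. \<exists>\<alpha>. A *v u + B *v \<alpha> \<preceq>\<^bsub>K\<^esub> a}"
    and U_feas: "ess_strictly_feasible (\<lambda>(u, \<alpha>). A *v u + B *v \<alpha>) K a"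
    and feas: "\<And>u. u \<in> U \<Longrightarrow>
        ess_strictly_feasible (\<lambda>(f, \<tau>, \<xi>). P *v f + \<tau> *\<^sub>R p + Q *v \<xi>) M (c - R *v u)"
    and le: "\<And>u f \<tau> \<xi>. u \<in> U \<Longrightarrow> P *v f + \<tau> *\<^sub>R p + Q *v \<xi> + R *v u \<preceq>\<^bsub>M\<^esub> c \<Longrightarrow> \<phi> u \<le> f \<bullet> v + \<tau>"
    and less: "\<And>u \<rho>. u \<in> U \<Longrightarrow> \<phi> u < \<rho> \<Longrightarrow>
      \<exists>f \<tau> \<xi>. P *v f + \<tau> *\<^sub>R p + Q *v \<xi> + R *v u \<preceq>\<^bsub>M\<^esub> c \<and> f \<bullet> v + \<tau> < \<rho>"
    and bdd: "bdd_above ((\<lambda>\<omega>. \<omega> \<bullet> h - \<phi> \<omega>) ` U)"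
  shows "(SUP \<omega>\<in>U. \<omega> \<bullet> h - \<phi> \<omega>) < s \<longleftrightarrow>
    (\<exists>\<theta>>0. \<exists>\<delta> \<epsilon>. transpose P *v \<delta> + v = 0 \<and> p \<bullet> \<delta> = - 1 \<and> transpose Q *v \<delta> = 0 \<and>
       transpose R *v \<delta> + transpose A *v \<epsilon> = h \<and> transpose B *v \<epsilon> = 0 \<and>
       \<delta> \<in> dual_cone M \<and> \<epsilon> \<in> dual_cone K \<and> \<theta> + c \<bullet> \<delta> + a \<bullet> \<epsilon> \<le> s)"
    (is "?l \<longleftrightarrow> ?r")
proof
  assume l: ?l
  define d where "d = (SUP \<omega>\<in>U. \<omega> \<bullet> h - \<phi> \<omega>)"
  let ?A = "\<lambda>(\<omega>, \<alpha>, f, \<tau>, \<xi>). (A *v \<omega> + B *v \<alpha>, P *v f + \<tau> *\<^sub>R p + Q *v \<xi> + R *v \<omega>)"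
  have lin: "linear ?A"
    by (rule linearI)
      (auto simp: matrix_vector_right_distrib matrix_vector_mult_scaleR algebra_simps)
  obtain z where z: "ess_interior_point K (a - (\<lambda>(u, \<alpha>). A *v u + B *v \<alpha>) z)"
    by (rule ess_strictly_feasible_imp_interior_point[OF U_feas])
  obtain u0 \<alpha>0 where u0: "ess_interior_point K (a - (A *v u0 + B *v \<alpha>0))"
    using z by (cases z) auto
  then have "u0 \<in> U" using ess_interior_point_in[OF u0] U(2) by (auto simp: cone_le_def)
  \<comment> \<open>The constraint of \<open>M\<close> depends on u, so its Slater point is taken at
    the \<open>u0\<close> that is already a Slater point for \<open>U\<close>.\<close>
  obtain z' where z': "ess_interior_point M (c - R *v u0 - (\<lambda>(f, \<tau>, \<xi>). P *v f + \<tau> *\<^sub>R p + Q *v \<xi>) z')"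
    by (rule ess_strictly_feasible_imp_interior_point[OF feas[OF \<open>u0 \<in> U\<close>]])
  obtain f0 \<tau>0 \<xi>0 where f0: "ess_interior_point M (c - (P *v f0 + \<tau>0 *\<^sub>R p + Q *v \<xi>0 + R *v u0))"
    using z' by (cases z') (auto simp: algebra_simps)
  have slater: "ess_interior_point (K \<times> M) ((a, c) - ?A (u0, \<alpha>0, f0, \<tau>0, \<xi>0))"
    using ess_interior_point_Times[OF u0 f0] by simp
  \<comment> \<open>The cost vector lists the coefficients of
    \<open>h \<bullet> \<omega> - v \<bullet> f - \<tau>\<close> in the order \<omega>, \<alpha>, f,
    \<tau>, \<xi>; each coefficient becomes one dual equation.\<close>
  have bound: "(h, 0, - v, - 1, 0) \<bullet> z \<le> d" if "(a, c) - ?A z \<in> K \<times> M" for z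
  proof -
    obtain \<omega> \<alpha> f \<tau> \<xi> where z: "z = (\<omega>, \<alpha>, f, \<tau>, \<xi>)" by (cases z)
    with that have *: "A *v \<omega> + B *v \<alpha> \<preceq>\<^bsub>K\<^esub> a" "P *v f + \<tau> *\<^sub>R p + Q *v \<xi> + R *v \<omega> \<preceq>\<^bsub>M\<^esub> c"
      by (simp_all add: cone_le_def)
    then have \<omega>: "\<omega> \<in> U" using U(2) by blast
    with cSUP_upper[OF \<omega> bdd] le[OF \<omega> *(2)] show ?thesis
      by (simp add: z d_def inner_commute)
  qed
  obtain y where y: "y \<in> dual_cone (K \<times> M)" "\<And>z. y \<bullet> ?A z = (h, 0, - v, - 1, 0) \<bullet> z" "y \<bullet> (a, c) \<le> d"
    using conic_duality[OF lin slater bound] by blast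
  obtain \<epsilon> \<delta> where \<epsilon>\<delta>: "y = (\<epsilon>, \<delta>)" by (cases y)
  have "0 \<in> K" "0 \<in> M"
    using u0 f0 by (auto dest: ess_interior_point_imp_convex_cone convex_cone_contains_0)
  then have dual: "\<epsilon> \<in> dual_cone K" "\<delta> \<in> dual_cone M"
    using y(1) by (auto simp: \<epsilon>\<delta> dual_cone_Times)
  have eq: "\<epsilon> \<bullet> (A *v \<omega> + B *v \<alpha>) + \<delta> \<bullet> (P *v f + \<tau> *\<^sub>R p + Q *v \<xi> + R *v \<omega>) = h \<bullet> \<omega> - v \<bullet> f - \<tau>"
    for \<omega> \<alpha> f \<tau> \<xi>
    using y(2)[of "(\<omega>, \<alpha>, f, \<tau>, \<xi>)"] by (simp add: \<epsilon>\<delta>)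
  \<comment> \<open>The dual equations follow by setting all variables but one to 0 in
    \<open>eq\<close>.\<close>
  have "transpose P *v \<delta> = - v" "transpose Q *v \<delta> = 0" "transpose B *v \<epsilon> = 0"
    using eq[of 0 0 _ 0 0] eq[of 0 0 0 0] eq[of 0 _ 0 0 0]
    by (intro transpose_mult_eqI; simp)+
  moreover have "p \<bullet> \<delta> = - 1"
    using eq[of 0 0 0 1 0] by (simp add: inner_commute)
  moreover have "transpose R *v \<delta> + transpose A *v \<epsilon> = h"
  proof -
    have "(transpose R *v \<delta> + transpose A *v \<epsilon>) \<bullet> \<omega> = h \<bullet> \<omega>" for \<omega>
      using eq[of \<omega> 0 0 0 0] by (simp add: inner_left_distrib dot_lmul_matrix)
    then show ?thesis by (metis vector_eq_rdot)
  qed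
  ultimately show ?r
    using l dual y(3)
    by (intro exI[of _ "s - d"] conjI exI[of _ \<delta>] exI[of _ \<epsilon>]) (auto simp: d_def \<epsilon>\<delta> inner_commute)
next
  assume ?r
  then obtain \<theta> \<delta> \<epsilon> where *: "\<theta> > 0" "transpose P *v \<delta> + v = 0" "p \<bullet> \<delta> = - 1" "transpose Q *v \<delta> = 0"
    "transpose R *v \<delta> + transpose A *v \<epsilon> = h" "transpose B *v \<epsilon> = 0"
    "\<delta> \<in> dual_cone M" "\<epsilon> \<in> dual_cone K" "\<theta> + c \<bullet> \<delta> + a \<bullet> \<epsilon> \<le> s" by blast
  have "(SUP \<omega>\<in>U. \<omega> \<bullet> h - \<phi> \<omega>) \<le> s - \<theta>"
  proof (rule cSUP_least[OF U(1)])
    fix \<omega> assume \<omega>: "\<omega> \<in> U"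
    then obtain \<alpha> where "A *v \<omega> + B *v \<alpha> \<preceq>\<^bsub>K\<^esub> a" using U(2) by blast
    from conic_multiplier_bound[OF *(8,6) this]
    have 1: "(transpose A *v \<epsilon>) \<bullet> \<omega> \<le> a \<bullet> \<epsilon>" by (simp add: inner_commute)
    \<comment> \<open>\<delta> certifies an affine minorant of \<phi>: its equations turn the
      pairing with the \<open>f\<close> and \<tau> terms into
      \<open>- (v \<bullet> f + \<tau>)\<close> and cancel \<xi>.\<close>
    have "(transpose R *v \<delta>) \<bullet> \<omega> - c \<bullet> \<delta> \<le> \<phi> \<omega>"
    proof (rule ccontr)
      assume "\<not> (transpose R *v \<delta>) \<bullet> \<omega> - c \<bullet> \<delta> \<le> \<phi> \<omega>"
      then obtain f \<tau> \<xi> where f: "P *v f + \<tau> *\<^sub>R p + Q *v \<xi> + R *v \<omega> \<preceq>\<^bsub>M\<^esub> c"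
        "f \<bullet> v + \<tau> < (transpose R *v \<delta>) \<bullet> \<omega> - c \<bullet> \<delta>"
        using less[OF \<omega>, of "(transpose R *v \<delta>) \<bullet> \<omega> - c \<bullet> \<delta>"] by auto
      have "\<delta> \<bullet> (P *v f) = - (v \<bullet> f)" "\<delta> \<bullet> (Q *v \<xi>) = 0" "\<delta> \<bullet> (R *v \<omega>) = (transpose R *v \<delta>) \<bullet> \<omega>"
        unfolding transpose_mult_inner[symmetric] using *(2,4)
        by (simp_all add: eq_neg_iff_add_eq_0[symmetric])
      with dual_cone_le[OF *(7), of c "P *v f + \<tau> *\<^sub>R p + Q *v \<xi> + R *v \<omega>"] f *(3) show False
        by (simp add: cone_le_def inner_right_distrib inner_commute)
    qed
    with 1 *(5,9) show "\<omega> \<bullet> h - \<phi> \<omega> \<le> s - \<theta>"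
      by (auto simp: inner_right_distrib inner_commute)
  qed
  with *(1) show ?l by simp
qed

section \<open>Saddle fields\<close>

text \<open>Difference quotients along the segment from \<open>x\<close> to \<open>y\<close> are at
  most \<open>f y - f x\<close>, and their limit at 0 is \<open>D (y - x)\<close>. Since the
  derivative is taken within \<open>S\<close>, where \<open>x\<close> may be a boundary point, the
  limit is one-sided.\<close>

lemma convex_on_gradient_inequality:
  fixes f :: "'a::real_normed_vector \<Rightarrow> real"
  assumes f: "convex_on S f" and x: "x \<in> S" and y: "y \<in> S"
    and D: "(f has_derivative D) (at x within S)"
  shows "D (y - x) \<le> f y - f x"
proof -
  define g where "g t = x + t *\<^sub>R (y - x)" for t :: real
  have "convex S" using f by (simp add: convex_on_def)
  have g_alt: "g t = (1 - t) *\<^sub>R x + t *\<^sub>R y" for t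
    by (simp add: g_def algebra_simps)
  have g_in: "g ` {0..1} \<subseteq> S"
    using x y \<open>convex S\<close> by (auto simp: g_alt convex_alt)
  have "(g has_derivative (\<lambda>t. t *\<^sub>R (y - x))) (at 0 within {0..1})"
    unfolding g_def by (auto intro!: derivative_eq_intros)
  moreover have "(f has_derivative D) (at (g 0) within g ` {0..1})"
    using D g_in by (auto simp: g_def intro: has_derivative_subset)
  ultimately have "((\<lambda>t. f (g t)) has_derivative (\<lambda>t. D (t *\<^sub>R (y - x)))) (at 0 within {0..1})"
    by (rule has_derivative_in_compose)
  moreover have "D (t *\<^sub>R (y - x)) = D (y - x) * t" for t
    using D by (simp add: has_derivative_scaleR[OF D] linear_cmul[OF has_derivative_linear[OF D]])
  ultimately have "((\<lambda>t. f (g t)) has_field_derivative D (y - x)) (at 0 within {0..1})"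
    by (simp add: has_field_derivative_def mult_commute_abs)
  then have lim: "((\<lambda>t. (f (g t) - f x) / t) \<longlongrightarrow> D (y - x)) (at 0 within {0..1})"
    by (simp add: has_field_derivative_iff g_def)
  show ?thesis
  proof (rule tendsto_upperbound[OF lim])
    show "\<forall>\<^sub>F t in at 0 within {0..1}. (f (g t) - f x) / t \<le> f y - f x"
      unfolding eventually_at_filter
    proof (rule always_eventually, intro allI impI)
      fix t :: real assume t: "t \<noteq> 0" "t \<in> {0..1}"
      have "f (g t) \<le> (1 - t) * f x + t * f y"
        using convex_onD[OF f _ _ x y, of t] t by (simp add: g_alt)
      then have "f (g t) - f x \<le> t * (f y - f x)" by (simp add: algebra_simps)
      then show "(f (g t) - f x) / t \<le> f y - f x"
        using t by (simp add: divide_le_eq mult.commute)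
    qed
    show "at 0 within {0..1::real} \<noteq> bot"
      by (simp add: at_within_Icc_at_right)
  qed
qed

text \<open>The joint expansion is restricted to the two slices through \<open>(u, v)\<close>; the
  concave slice is negated.\<close>

lemma saddle_partial_gradient_inequalities:
  fixes \<psi> :: "'u::euclidean_space \<Rightarrow> 'v::euclidean_space \<Rightarrow> real"
  assumes cc: "convex_concave U V \<psi>" and G: "continuous_gradient_field (\<lambda>(u, v). \<psi> u v) (U \<times> V) G"
    and u: "u \<in> U" and v: "v \<in> V"
  shows "\<omega> \<in> U \<Longrightarrow> fst (G (u, v)) \<bullet> (\<omega> - u) \<le> \<psi> \<omega> v - \<psi> u v"
    and "\<zeta> \<in> V \<Longrightarrow> \<psi> u \<zeta> - \<psi> u v \<le> snd (G (u, v)) \<bullet> (\<zeta> - v)"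
proof -
  have D: "((\<lambda>(u, v). \<psi> u v) has_derivative (\<lambda>d. G (u, v) \<bullet> d)) (at (u, v) within S)" if "S \<subseteq> U \<times> V" for S
    using G u v that by (auto simp: continuous_gradient_field_def intro: has_derivative_subset)
  have "((\<lambda>\<omega>. (\<omega>, v)) has_derivative (\<lambda>d. (d, 0))) (at u within U)"
    by (auto intro!: derivative_eq_intros)
  then have "((\<lambda>\<omega>. \<psi> \<omega> v) has_derivative (\<lambda>d. G (u, v) \<bullet> (d, 0))) (at u within U)"
    using has_derivative_in_compose[of "\<lambda>\<omega>. (\<omega>, v)" _ u U, OF _ D] v by auto
  moreover have "convex_on U (\<lambda>\<omega>. \<psi> \<omega> v)" using cc v by (simp add: convex_concave_def)
  ultimately show "\<omega> \<in> U \<Longrightarrow> fst (G (u, v)) \<bullet> (\<omega> - u) \<le> \<psi> \<omega> v - \<psi> u v"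
    using convex_on_gradient_inequality[of U _ u \<omega>] u by (force simp: inner_prod_def)
  have "(Pair u has_derivative (\<lambda>d. (0, d))) (at v within V)"
    by (auto intro!: derivative_eq_intros)
  then have "(\<psi> u has_derivative (\<lambda>d. G (u, v) \<bullet> (0, d))) (at v within V)"
    using has_derivative_in_compose[of "Pair u" _ v V, OF _ D] u by auto
  then have "((\<lambda>\<zeta>. - \<psi> u \<zeta>) has_derivative (\<lambda>d. - (G (u, v) \<bullet> (0, d)))) (at v within V)"
    by (rule has_derivative_minus)
  moreover have "convex_on V (\<lambda>\<zeta>. - \<psi> u \<zeta>)" using cc u by (simp add: convex_concave_def concave_on_def)
  ultimately show "\<zeta> \<in> V \<Longrightarrow> \<psi> u \<zeta> - \<psi> u v \<le> snd (G (u, v)) \<bullet> (\<zeta> - v)"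
    using convex_on_gradient_inequality[of V _ v \<zeta>] v by (force simp: inner_prod_def)
qed

text \<open>Add the two gradient inequalities at \<open>(\<omega>, \<zeta>)\<close>, taken towards
  \<open>u\<close> and \<open>v\<close>; the common value \<open>\<psi> \<omega> \<zeta>\<close>
  cancels.\<close>

lemma saddle_field_inner_le:
  fixes \<psi> :: "'u::euclidean_space \<Rightarrow> 'v::euclidean_space \<Rightarrow> real"
  assumes "convex_concave U V \<psi>" "continuous_gradient_field (\<lambda>(u, v). \<psi> u v) (U \<times> V) G"
    and "u \<in> U" "v \<in> V" "\<omega> \<in> U" "\<zeta> \<in> V"
  shows "saddle_field G (\<omega>, \<zeta>) \<bullet> ((u, v) - (\<omega>, \<zeta>)) \<le> \<psi> u \<zeta> - \<psi> \<omega> v"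
  using saddle_partial_gradient_inequalities[OF assms(1,2,5,6)] assms(3,4)
  by (fastforce simp: saddle_field_def)

text \<open>A real \<open>SUP\<close> bounds its members only if they are bounded above. Compactness
  gives this, with continuity of \<psi> coming from its differentiability.\<close>

lemma bdd_above_saddle_values:
  fixes \<psi> :: "'u::euclidean_space \<Rightarrow> 'v::euclidean_space \<Rightarrow> real"
  assumes "compact U" "compact V" and G: "continuous_gradient_field (\<lambda>(u, v). \<psi> u v) (U \<times> V) G"
  shows "u \<in> U \<Longrightarrow> bdd_above ((\<lambda>\<zeta>. \<zeta> \<bullet> e + \<psi> u \<zeta>) ` V)"
    and "v \<in> V \<Longrightarrow> bdd_above ((\<lambda>\<omega>. \<omega> \<bullet> h - \<psi> \<omega> v) ` U)"
proof -
  have cont: "continuous_on (U \<times> V) (\<lambda>(u, v). \<psi> u v)"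
    using G unfolding continuous_gradient_field_def continuous_on_eq_continuous_within
    by (blast intro: has_derivative_continuous)
  show "bdd_above ((\<lambda>\<zeta>. \<zeta> \<bullet> e + \<psi> u \<zeta>) ` V)" if "u \<in> U"
  proof (intro bounded_imp_bdd_above compact_imp_bounded compact_continuous_image continuous_intros assms)
    show "continuous_on V (\<psi> u)"
      using continuous_on_compose2[OF cont, of V "Pair u"] that by (fastforce intro: continuous_intros)
  qed
  show "bdd_above ((\<lambda>\<omega>. \<omega> \<bullet> h - \<psi> \<omega> v) ` U)" if "v \<in> V"
  proof (intro bounded_imp_bdd_above compact_imp_bounded compact_continuous_image continuous_intros assms)
    show "continuous_on U (\<lambda>\<omega>. \<psi> \<omega> v)"
      using continuous_on_compose2[OF cont, of U "\<lambda>\<omega>. (\<omega>, v)"] that by (fastforce intro: continuous_intros)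
  qed
qed

text \<open>For y = (\<omega>, \<zeta>), evaluating the suprema at \<zeta> and \<omega> bounds
  \<open>t - g \<bullet> y\<close> below by \<open>\<psi> u \<zeta> - \<psi> \<omega> v\<close>,
  which dominates the field term.\<close>

lemma saddle_Z_subset_calF:
  fixes \<psi> :: "'u::euclidean_space \<Rightarrow> 'v::euclidean_space \<Rightarrow> real"
  assumes "compact U" "compact V" "convex_concave U V \<psi>"
    and G: "continuous_gradient_field (\<lambda>(u, v). \<psi> u v) (U \<times> V) G"
  shows "saddle_Z U V \<psi> \<subseteq> calF (saddle_field G) (U \<times> V)"
proof (clarsimp simp: saddle_Z_def calF_def simp del: diff_Pair inner_Pair)
  fix t h e u v r s \<omega> \<zeta>
  assume *: "u \<in> U" "v \<in> V" "(SUP \<zeta>\<in>V. \<zeta> \<bullet> e + \<psi> u \<zeta>) < r" "(SUP \<omega>\<in>U. \<omega> \<bullet> h - \<psi> \<omega> v) < s"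
    "r + s \<le> t" "\<omega> \<in> U" "\<zeta> \<in> V"
  note bdd = bdd_above_saddle_values[OF assms(1,2) G]
  have "\<zeta> \<bullet> e + \<psi> u \<zeta> < r" "\<omega> \<bullet> h - \<psi> \<omega> v < s"
    using cSUP_upper[OF *(7) bdd(1)[OF *(1)]] cSUP_upper[OF *(6) bdd(2)[OF *(2)]] *(3,4)
    by (meson le_less_trans)+
  with saddle_field_inner_le[OF assms(3) G *(1,2,6,7)] *(5)
  show "saddle_field G (\<omega>, \<zeta>) \<bullet> ((u, v) - (\<omega>, \<zeta>)) \<le> t - (h, e) \<bullet> (\<omega>, \<zeta>)"
    by (simp add: inner_commute)
qed

lemma saddle_field_in_saddle_Z:
  fixes \<psi> :: "'u::euclidean_space \<Rightarrow> 'v::euclidean_space \<Rightarrow> real"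
  assumes cc: "convex_concave U V \<psi>"
    and G: "continuous_gradient_field (\<lambda>(u, v). \<psi> u v) (U \<times> V) G"
    and x: "x \<in> U \<times> V" and t: "x \<bullet> saddle_field G x < t"
  shows "(t, saddle_field G x, x) \<in> saddle_Z U V \<psi>"
proof -
  obtain u v where uv: "x = (u, v)" "u \<in> U" "v \<in> V" using x by auto
  obtain h e where he: "saddle_field G x = (h, e)" by (cases "saddle_field G x")
  then have he': "h = fst (G (u, v))" "e = - snd (G (u, v))" by (auto simp: saddle_field_def uv)
  \<comment> \<open>The two maxima at g = F(x) sum to \<open>x \<bullet> saddle_field G x\<close>,
    so half of the excess of \<open>t\<close> goes to each of r and s.\<close>
  define d where "d = (t - x \<bullet> saddle_field G x) / 2"
  have d: "d > 0" using t by (simp add: d_def)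
  have "(SUP \<zeta>\<in>V. \<zeta> \<bullet> e + \<psi> u \<zeta>) \<le> v \<bullet> e + \<psi> u v"
  proof (rule cSUP_least)
    fix \<zeta> assume "\<zeta> \<in> V"
    from saddle_partial_gradient_inequalities(2)[OF cc G uv(2,3) this]
    show "\<zeta> \<bullet> e + \<psi> u \<zeta> \<le> v \<bullet> e + \<psi> u v"
      by (simp add: he' inner_diff_left inner_commute)
  qed (use uv in auto)
  moreover have "(SUP \<omega>\<in>U. \<omega> \<bullet> h - \<psi> \<omega> v) \<le> u \<bullet> h - \<psi> u v"
  proof (rule cSUP_least)
    fix \<omega> assume "\<omega> \<in> U"
    from saddle_partial_gradient_inequalities(1)[OF cc G uv(2,3) this]
    show "\<omega> \<bullet> h - \<psi> \<omega> v \<le> u \<bullet> h - \<psi> u v"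
      by (simp add: he' inner_diff_left inner_commute)
  qed (use uv in auto)
  moreover have "x \<bullet> saddle_field G x = u \<bullet> h + v \<bullet> e" unfolding he by (simp add: uv)
  then have "v \<bullet> e + \<psi> u v + d + (u \<bullet> h - \<psi> u v + d) \<le> t"
    unfolding d_def by (simp add: field_simps)
  ultimately have "(SUP \<zeta>\<in>V. \<zeta> \<bullet> e + \<psi> u \<zeta>) < v \<bullet> e + \<psi> u v + d"
    "(SUP \<omega>\<in>U. \<omega> \<bullet> h - \<psi> \<omega> v) < u \<bullet> h - \<psi> u v + d"
    "v \<bullet> e + \<psi> u v + d + (u \<bullet> h - \<psi> u v + d) \<le> t"
    using d by auto
  then show ?thesis
    unfolding he unfolding saddle_Z_def using uv by blast
qed

text \<open>The upper bound of \<open>saddle_field_inner_le\<close> changes sign when the two points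
  are exchanged, so the two instances add up to 0.\<close>

lemma monotone_saddle_field:
  fixes \<psi> :: "'u::euclidean_space \<Rightarrow> 'v::euclidean_space \<Rightarrow> real"
  assumes "convex_concave U V \<psi>" "continuous_gradient_field (\<lambda>(u, v). \<psi> u v) (U \<times> V) G"
  shows "monotone_field (U \<times> V) (saddle_field G)"
  unfolding monotone_field_def
proof (clarify)
  fix u v \<omega> \<zeta> assume *: "u \<in> U" "v \<in> V" "\<omega> \<in> U" "\<zeta> \<in> V"
  have "saddle_field G (u, v) \<bullet> ((\<omega>, \<zeta>) - (u, v)) = - (saddle_field G (u, v) \<bullet> ((u, v) - (\<omega>, \<zeta>)))"
    by (metis inner_minus_right minus_diff_eq)
  with saddle_field_inner_le[OF assms *] saddle_field_inner_le[OF assms *(3,4,1,2)]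
  show "0 \<le> (saddle_field G (u, v) - saddle_field G (\<omega>, \<zeta>)) \<bullet> ((u, v) - (\<omega>, \<zeta>))"
    unfolding inner_diff_left by linarith
qed

section \<open>Assembly of the almost representation\<close>

theorem mainTheorem13:
  fixes \<K> :: "real list set set"
    and U :: "(real ^ 'nu) set" and V :: "(real ^ 'nv) set"
    and A :: "real ^ 'nu ^ ('k::{finite,linorder})" and B :: "(real ^ 'na, 'k) vec"
    and K :: "(real, 'k) vec set" and a :: "(real, 'k) vec"
    and C :: "real ^ 'nv ^ ('l::{finite,linorder})" and D :: "(real ^ 'nb, 'l) vec"
    and L :: "(real, 'l) vec set" and b :: "(real, 'l) vec"
    and P :: "real ^ 'nv ^ ('m::{finite,linorder})" and p :: "(real, 'm) vec"
    and Q :: "(real ^ 'nx, 'm) vec" and R :: "(real ^ 'nu, 'm) vec"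
    and M :: "(real, 'm) vec set" and c :: "(real, 'm) vec"
    and \<psi> :: "real ^ 'nu \<Rightarrow> real ^ 'nv \<Rightarrow> real"
    and G :: "(real ^ 'nu) \<times> (real ^ 'nv) \<Rightarrow> (real ^ 'nu) \<times> (real ^ 'nv)"
  assumes family: "cone_family \<K>"
    and lorentz: "lorentz_cone3 \<in> \<K>"
    and U: "compact U" "U \<noteq> {}"
    and V: "compact V" "V \<noteq> {}"
    and cones: "coords ` K \<in> \<K>" "coords ` L \<in> \<K>" "coords ` M \<in> \<K>"
    and U_repr: "U = {u. \<exists>\<alpha>. A *v u + B *v \<alpha> \<preceq>\<^bsub>K\<^esub> a}"
    and U_feas: "ess_strictly_feasible (\<lambda>(u, \<alpha>). A *v u + B *v \<alpha>) K a"
    and V_repr: "V = {v. \<exists>\<beta>. C *v v + D *v \<beta> \<preceq>\<^bsub>L\<^esub> b}"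
    and V_feas: "ess_strictly_feasible (\<lambda>(v, \<beta>). C *v v + D *v \<beta>) L b"
    and psi_cc: "convex_concave U V \<psi>"
    and psi_grad: "continuous_gradient_field (\<lambda>(u, v). \<psi> u v) (U \<times> V) G"
    and psi_repr: "\<And>u v. u \<in> U \<Longrightarrow> v \<in> V \<Longrightarrow>
        ereal (\<psi> u v) =
          (INF (f, \<tau>, \<xi>) \<in> {(f, \<tau>, \<xi>). P *v f + \<tau> *\<^sub>R p + Q *v \<xi> + R *v u \<preceq>\<^bsub>M\<^esub> c}.
             ereal (f \<bullet> v + \<tau>))"
    and psi_feas: "\<And>u. u \<in> U \<Longrightarrow>
        ess_strictly_feasible (\<lambda>(f, \<tau>, \<xi>). P *v f + \<tau> *\<^sub>R p + Q *v \<xi>) M (c - R *v u)"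
  shows "(saddle_Z U V \<psi> \<subseteq> calF (saddle_field G) (U \<times> V) \<and>
          (\<forall>t g x. x \<in> U \<times> V \<and> g = saddle_field G x \<and> t > x \<bullet> saddle_field G x \<longrightarrow>
             (t, g, x) \<in> saddle_Z U V \<psi>)) \<and>
         saddle_Z U V \<psi> = proj_tgx (saddle_system A B K a C D L b P p Q R M c) \<and>
         almost_representation \<K> (saddle_field G) (U \<times> V)
           (saddle_system A B K a C D L b P p Q R M c)"
proof -
  let ?X = "U \<times> V" and ?F = "saddle_field G"
  let ?S = "saddle_system A B K a C D L b P p Q R M c"
  let ?feas = "\<lambda>u f \<tau> \<xi>. P *v f + \<tau> *\<^sub>R p + Q *v \<xi> + R *v u \<preceq>\<^bsub>M\<^esub> c"
  obtain u0 v0 where uv0: "u0 \<in> U" "v0 \<in> V" using U(2) V(2) by blast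
  have ccK: "convex_cone K" "convex_cone L" "convex_cone M"
    using U_feas V_feas psi_feas[OF uv0(1)]
    by (meson ess_strictly_feasible_imp_interior_point ess_interior_point_imp_convex_cone)+
  then have conv: "convex K" "convex L" "convex M" and nonempty: "K \<noteq> {}" "L \<noteq> {}" "M \<noteq> {}"
    by (simp_all add: convex_cone_def)
  have UV: "convex U" "convex V"
    unfolding U_repr V_repr using conv by (auto intro: convex_conic_representation)
  \<comment> \<open>The extended-real infimum enters only through \<open>le\<close> and
    \<open>less\<close>: it is a lower bound of the feasible values, and every real level above it
    is undercut by one of them.\<close>
  have le: "\<psi> u v \<le> f \<bullet> v + \<tau>" if "u \<in> U" "v \<in> V" "?feas u f \<tau> \<xi>" for u v f \<tau> \<xi>
  proof -
    have "ereal (\<psi> u v) \<le> (case (f, \<tau>, \<xi>) of (f, \<tau>, \<xi>) \<Rightarrow> ereal (f \<bullet> v + \<tau>))"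
      unfolding psi_repr[OF that(1,2)] by (rule INF_lower) (use that(3) in simp)
    then show ?thesis by simp
  qed
  have less: "\<exists>f \<tau> \<xi>. ?feas u f \<tau> \<xi> \<and> f \<bullet> v + \<tau> < \<rho>" if "u \<in> U" "v \<in> V" "\<psi> u v < \<rho>" for u v \<rho>
  proof -
    have "ereal (\<psi> u v) < ereal \<rho>" using that(3) by simp
    then show ?thesis
      unfolding psi_repr[OF that(1,2)] INF_less_iff by auto
  qed
  note bdd = bdd_above_saddle_values[OF U(1) V(1) psi_grad]
  have r_iff: "(SUP \<zeta>\<in>V. \<zeta> \<bullet> e + \<psi> u \<zeta>) < r \<longleftrightarrow>
    (\<exists>\<theta>>0. \<exists>f \<tau> \<xi> \<gamma>. ?feas u f \<tau> \<xi> \<and>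
       transpose C *v \<gamma> = f + e \<and> transpose D *v \<gamma> = 0 \<and> \<gamma> \<in> dual_cone L \<and> \<theta> + \<gamma> \<bullet> b + \<tau> \<le> r)"
    if "u \<in> U" for u e r
    by (rule SUP_add_less_iff[OF V(1) UV(2) V(2) V_repr V_feas conv(3) le[OF that] less[OF that] bdd(1)[OF that]])
  have s_iff: "(SUP \<omega>\<in>U. \<omega> \<bullet> h - \<psi> \<omega> v) < s \<longleftrightarrow>
    (\<exists>\<theta>>0. \<exists>\<delta> \<epsilon>. transpose P *v \<delta> + v = 0 \<and> p \<bullet> \<delta> = - 1 \<and> transpose Q *v \<delta> = 0 \<and>
       transpose R *v \<delta> + transpose A *v \<epsilon> = h \<and> transpose B *v \<epsilon> = 0 \<and>
       \<delta> \<in> dual_cone M \<and> \<epsilon> \<in> dual_cone K \<and> \<theta> + c \<bullet> \<delta> + a \<bullet> \<epsilon> \<le> s)"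
    if "v \<in> V" for v h s
    by (rule SUP_diff_less_iff[OF U(2) U_repr U_feas psi_feas le[OF _ that] less[OF _ that] bdd(2)[OF that]])
  have pos_iff: "0 < \<theta> \<longleftrightarrow> (\<exists>\<eta>. \<eta> \<ge> 0 \<and> \<theta> \<ge> 0 \<and> \<eta> * \<theta> \<ge> 1)" for \<theta> :: real
  proof
    assume "0 < \<theta>"
    then show "\<exists>\<eta>. \<eta> \<ge> 0 \<and> \<theta> \<ge> 0 \<and> \<eta> * \<theta> \<ge> 1" by (intro exI[of _ "1 / \<theta>"]) auto
  qed (auto simp: order_le_less)
  have U_iff: "u \<in> U \<longleftrightarrow> (\<exists>\<alpha>. A *v u + B *v \<alpha> \<preceq>\<^bsub>K\<^esub> a)" for u using U_repr by blast
  have V_iff: "v \<in> V \<longleftrightarrow> (\<exists>\<beta>. C *v v + D *v \<beta> \<preceq>\<^bsub>L\<^esub> b)" for v using V_repr by blast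
  have Z_eq: "saddle_Z U V \<psi> = proj_tgx ?S"
  proof (rule set_eqI)
    fix q :: "real \<times> ((real ^ 'nu) \<times> (real ^ 'nv)) \<times> (real ^ 'nu) \<times> (real ^ 'nv)"
    obtain t h e u v where q: "q = (t, (h, e), (u, v))" by (metis prod.exhaust)
    have "q \<in> saddle_Z U V \<psi> \<longleftrightarrow> u \<in> U \<and> v \<in> V \<and> (\<exists>r s. (SUP \<zeta>\<in>V. \<zeta> \<bullet> e + \<psi> u \<zeta>) < r \<and>
        (SUP \<omega>\<in>U. \<omega> \<bullet> h - \<psi> \<omega> v) < s \<and> r + s \<le> t)"
      by (simp add: saddle_Z_def q)
    also have "\<dots> \<longleftrightarrow> q \<in> proj_tgx ?S"
    proof
      assume "u \<in> U \<and> v \<in> V \<and> (\<exists>r s. (SUP \<zeta>\<in>V. \<zeta> \<bullet> e + \<psi> u \<zeta>) < r \<and>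
        (SUP \<omega>\<in>U. \<omega> \<bullet> h - \<psi> \<omega> v) < s \<and> r + s \<le> t)"
      then obtain r s where uv: "u \<in> U" "v \<in> V" and rs: "(SUP \<zeta>\<in>V. \<zeta> \<bullet> e + \<psi> u \<zeta>) < r"
        "(SUP \<omega>\<in>U. \<omega> \<bullet> h - \<psi> \<omega> v) < s" "r + s \<le> t" by blast
      obtain \<theta> f \<tau> \<xi> \<gamma> where 1: "0 < \<theta>" "?feas u f \<tau> \<xi>" "transpose C *v \<gamma> = f + e"
        "transpose D *v \<gamma> = 0" "\<gamma> \<in> dual_cone L" "\<theta> + \<gamma> \<bullet> b + \<tau> \<le> r"
        using rs(1) r_iff[OF uv(1)] by blast
      obtain \<theta>' \<delta> \<epsilon> where 2: "0 < \<theta>'" "transpose P *v \<delta> + v = 0" "p \<bullet> \<delta> = - 1"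
        "transpose Q *v \<delta> = 0" "transpose R *v \<delta> + transpose A *v \<epsilon> = h" "transpose B *v \<epsilon> = 0"
        "\<delta> \<in> dual_cone M" "\<epsilon> \<in> dual_cone K" "\<theta>' + c \<bullet> \<delta> + a \<bullet> \<epsilon> \<le> s"
        using rs(2) s_iff[OF uv(2)] by blast
      obtain \<eta> \<eta>' where \<eta>: "\<eta> \<ge> 0 \<and> \<theta> \<ge> 0 \<and> \<eta> * \<theta> \<ge> 1" "\<eta>' \<ge> 0 \<and> \<theta>' \<ge> 0 \<and> \<eta>' * \<theta>' \<ge> 1"
        using 1(1) 2(1) pos_iff by meson
      obtain \<alpha> \<beta> where \<alpha>\<beta>: "A *v u + B *v \<alpha> \<preceq>\<^bsub>K\<^esub> a" "C *v v + D *v \<beta> \<preceq>\<^bsub>L\<^esub> b"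
        using uv U_iff V_iff by blast
      have "0 \<preceq>\<^bsub>dual_cone L\<^esub> \<gamma>" "0 \<preceq>\<^bsub>dual_cone M\<^esub> \<delta>" "0 \<preceq>\<^bsub>dual_cone K\<^esub> \<epsilon>"
        using 1(5) 2(7,8) by (simp_all add: cone_le_def)
      then have "(t, (h, e), (u, v), r, s, f, \<tau>, \<xi>, \<alpha>, \<beta>, \<gamma>, \<eta>, \<theta>, \<delta>, \<epsilon>, \<eta>', \<theta>') \<in> ?S"
        unfolding saddle_system_def mem_Collect_eq split_conv using rs(3) 1 2 \<eta> \<alpha>\<beta> by blast
      then show "q \<in> proj_tgx ?S" unfolding proj_tgx_def q by blast
    next
      assume "q \<in> proj_tgx ?S"
      then obtain r s f \<tau> \<xi> \<alpha> \<beta> \<gamma> \<eta> \<theta> \<delta> \<epsilon> \<eta>' \<theta>' where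
        "(t, (h, e), (u, v), r, s, f, \<tau>, \<xi>, \<alpha>, \<beta>, \<gamma>, \<eta>, \<theta>, \<delta>, \<epsilon>, \<eta>', \<theta>') \<in> ?S"
        unfolding proj_tgx_def q mem_Collect_eq split_conv by (metis prod.exhaust)
      note S = this[unfolded saddle_system_def mem_Collect_eq split_conv]
      have uv: "u \<in> U" "v \<in> V" using S U_iff V_iff by blast+
      have \<theta>: "0 < \<theta>" "0 < \<theta>'" using S pos_iff by blast+
      have dual: "\<gamma> \<in> dual_cone L" "\<delta> \<in> dual_cone M" "\<epsilon> \<in> dual_cone K"
        using S by (simp_all add: cone_le_def)
      have "(SUP \<zeta>\<in>V. \<zeta> \<bullet> e + \<psi> u \<zeta>) < r"
        using S r_iff[OF uv(1)] \<theta>(1) dual(1) by blast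
      moreover have "(SUP \<omega>\<in>U. \<omega> \<bullet> h - \<psi> \<omega> v) < s"
        using S s_iff[OF uv(2)] \<theta>(2) dual(2,3) by blast
      ultimately show "u \<in> U \<and> v \<in> V \<and> (\<exists>r s. (SUP \<zeta>\<in>V. \<zeta> \<bullet> e + \<psi> u \<zeta>) < r \<and>
        (SUP \<omega>\<in>U. \<omega> \<bullet> h - \<psi> \<omega> v) < s \<and> r + s \<le> t)"
        using S uv by blast
    qed
    finally show "q \<in> saddle_Z U V \<psi> \<longleftrightarrow> q \<in> proj_tgx ?S" .
  qed
  have sub: "saddle_Z U V \<psi> \<subseteq> calF ?F ?X"
    by (rule saddle_Z_subset_calF[OF U(1) V(1) psi_cc psi_grad])
  have mem: "(t, ?F x, x) \<in> saddle_Z U V \<psi>" if "x \<in> ?X" "x \<bullet> ?F x < t" for t x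
    by (rule saddle_field_in_saddle_Z[OF psi_cc psi_grad that])
  have up: "(t', g, x) \<in> saddle_Z U V \<psi>" if "(t, g, x) \<in> saddle_Z U V \<psi>" "t \<le> t'" for t t' g x
    using that unfolding saddle_Z_def by (fastforce intro: order_trans)
  have "continuous_on ?X ?F"
    unfolding saddle_field_def
    using psi_grad by (auto simp: continuous_gradient_field_def intro!: continuous_intros)
  moreover have "is_conic_solution_set \<K> ?S"
    by (intro conic_set_imp_solution_set conic_set_saddle_system family lorentz cones nonempty)
  moreover have "{(t, ?F x, x) | t x. x \<in> ?X \<and> t > ?F x \<bullet> x} \<subseteq> saddle_Z U V \<psi>"
    using mem by (auto simp: inner_commute)
  ultimately have "almost_representation \<K> ?F ?X ?S"
    unfolding almost_representation_def Z_eq[symmetric]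
    using uv0 UV sub up monotone_saddle_field[OF psi_cc psi_grad] by (auto intro: convex_Times)
  with sub mem Z_eq show ?thesis by blast
qed

end
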